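(* Consider the high-order (second-order in space) Lagrangian finite volume scheme with WENO reconstruction, HLLC numerical flux and forward Euler time discretization for the two-dimensional special relativistic hydrodynamics equations on a quadrilateral mesh, $$\overline U_{ij}^{n+1}A_{ij}^{n+1}=\overline U_{ij}^{n}A_{ij}^{n}-\Delta t^n\sum_{m=1}^{4}\sum_{\alpha=1}^{3}\omega_\alpha\,\widehat{\mathcal F}_{\mathbf n_{ij}^m}\big((U_{m,ij}^{\alpha})^{-},(U_{m,ij}^{\alpha})^{+}\big)\,|l_{ij}^m|,$$ with Simpson weights $\omega_1=\omega_3=\frac16$, $\omega_2=\frac23$. If $\overline U_{ij}^{n}\in\mathcal G$ and $U_{m,ij}^{\ast\ast}\in\mathcal G$ for all $m,i,j$, and the HLLC wave speeds are estimated by $$s^{-}=\min\big(s_{\min}(U^{-}),s_{\min}(U^{+})\big),\qquad s^{+}=\max\big(s_{\max}(U^{-}),s_{\max}(U^{+})\big),$$ then the scheme is physical-constraints-preserving, i.e. $\overline U_{ij}^{n+1}\in\mathcal G$ for all $i=1,\dots,N_x$, $j=1,\dots,N_y$, under the time step restriction $$\Delta t^n\le\frac{\omega_1}{4}\lambda\min_{i,j,\alpha}\left\{\frac{J_{ij}}{\sum_{m=1}^4|l_{ij}^m|}\Big/\max_{W_{ij}^{\alpha}\in\mathcal P}\big(|s_{\min}(W_{ij}^{\alpha})|,|s_{\max}(W_{ij}^{\alpha})|\big)\right\},$$ where the CFL number satisfies $\lambda\le\frac12$, $$J_{ij}=\min_{\alpha=1,2,3}\{J_{ij}^{\alpha,1},J_{ij}^{3,\alpha},J_{ij}^{\alpha,3},J_{ij}^{1,\alpha}\},\qquad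 \mathcal P=\{U_{1,ij}^{\alpha,1},\,U_{2,ij}^{3,\alpha},\,U_{3,ij}^{\alpha,3},\,U_{4,ij}^{1,\alpha}\}.$$
   Context: Units are such that the speed of light is $1$. The equations are $\partial_tU+\sum_{\ell=1}^2\partial_{x_\ell}F_\ell(U)=0$ with $U=(D,\mathbf m,E)^T$, $F_\ell=(Du_\ell,\mathbf m u_\ell+p\,\mathbf e_\ell,(E+p)u_\ell)^T$, where $D=\rho\gamma$, $\mathbf m=Dh\gamma\mathbf u$, $E=Dh\gamma-p$, $\gamma=(1-|\mathbf u|^2)^{-1/2}$, $h=1+e+p/\rho$; $\rho$ is the rest-mass density, $\mathbf u=(u_1,u_2)$ the velocity, $p$ the pressure, $e$ the specific internal energy, and $p=(\Gamma-1)\rho e$ with adiabatic index $\Gamma\in(1,2]$. The admissible set is $\mathcal G=\{U=(D,\mathbf m,E)^T:\ \rho>0,\ p>0,\ |\mathbf u|<1\}$. Wave speeds. For a unit normal $\mathbf n$ of the cell edge under consideration, with unit tangent $\tau$, write $m_n=\mathbf m\cdot\mathbf n$, $u_n=\mathbf u\cdot\mathbf n$, $u_\tau=\mathbf u\cdot\tau$. With $c_s=\sqrt{\Gamma p/(\rho h)}$ and $\sigma_s=c_s^2/[\gamma^2(1-c_s^2)]$, $$s_{\min}(U)=\frac{u_n-\sqrt{\sigma_s(1-u_n^2+\sigma_s)}}{1+\sigma_s},\qquad s_{\max}(U)=\frac{u_n+\sqrt{\sigma_s(1-u_n^2+\sigma_s)}}{1+\sigma_s}.$$ HLLC flux in direction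 $\mathbf n$. For left and right states $U^{\mp}$ (superscripts $\pm$ on other quantities refer to $U^\pm$) and wave speeds $s^{\pm}$, put $A^{\pm}=s^{\pm}E^{\pm}-m_n^{\pm}$, $B^{\pm}=m_n^{\pm}(s^{\pm}-u_n^{\pm})-p^{\pm}$, $\mathcal C_0=B^{+}-B^{-}$, $\mathcal C_1=A^{-}+s^{+}B^{-}-A^{+}-s^{-}B^{+}$, $\mathcal C_2=s^{-}A^{+}-s^{+}A^{-}$. The contact speed and intermediate pressure are $$s^{\ast}=\frac{-\mathcal C_1-\sqrt{\mathcal C_1^2-4\mathcal C_0\mathcal C_2}}{2\mathcal C_2},\qquad p^{\ast}=\frac{s^{\ast}A^{-}-B^{-}}{1-s^{-}s^{\ast}}=\frac{s^{\ast}A^{+}-B^{+}}{1-s^{+}s^{\ast}},$$ and the Lagrangian HLLC numerical flux is $\widehat{\mathcal F}_{\mathbf n}(U^-,U^+)=(0,\,p^{\ast}\mathbf n,\,p^{\ast}s^{\ast})^T$. Mesh. At time $t_n$ the computational domain is partitioned into $N_x\times N_y$ quadrilateral cells $I_{ij}^n$ with straight edges; $A_{ij}^n$ is the area of $I_{ij}^n$, and $|l_{ij}^m|$, $\mathbf n_{ij}^m$ are the length and unit outward normal of its $m$th edge, $m=1,\dots,4$. $\overline U_{ij}^n$ is the cell average approximation of $U$ on $I_{ij}^n$ at $t_n$. A coordinate transformation $\mathbf x=\mathbf x_{ij}(\hat x,\hat y)$ relates $I_{ij}^n$ to the unit square $[-\frac12,\frac12]^2$; edges $m=1,2,3,4$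 correspond to $\hat y=-\frac12$, $\hat x=\frac12$, $\hat y=\frac12$, $\hat x=-\frac12$. With $\hat x_1=\hat y_1=-\frac12$, $\hat x_2=\hat y_2=0$, $\hat x_3=\hat y_3=\frac12$, $J_{ij}^{\alpha,\beta}=\left|\frac{\partial(x_{ij},y_{ij})}{\partial(\hat x,\hat y)}\right|(\hat x_\alpha,\hat y_\beta)$ is the Jacobian of the transformation at the tensor-product Simpson (3-point Gauss–Lobatto) points. Reconstruction. $(U_{m,ij}^\alpha)^{-}$ and $(U_{m,ij}^\alpha)^{+}$, $\alpha=1,2,3$, are the approximations of $U$ at the $\alpha$th Simpson point of the $m$th edge (endpoints and midpoint) from inside and outside $I_{ij}^n$, respectively. The inside values are also written $U_{1,ij}^{\alpha,1}=(U_{1,ij}^\alpha)^-$, $U_{2,ij}^{3,\alpha}=(U_{2,ij}^\alpha)^-$, $U_{3,ij}^{\alpha,3}=(U_{3,ij}^\alpha)^-$, $U_{4,ij}^{1,\alpha}=(U_{4,ij}^\alpha)^-$, the upper indices being those of the point $(\hat x_\alpha,\hat y_\beta)$. They are obtained by a WENO reconstruction: the cell averages on $I_{ij}^n$ and its four edge neighbors are rotated to local coordinates $(\xi,\eta)$ normal and tangential to the edge and multiplied by the left eigenvector matrix of the Jacobian of the normal flux at $\overline U_{ij}^n$; on each of the four stencils consisting of $I_{ij}^n$, one of $I_{i\pm1,j}^n$ and one of $I_{i,j\pm1}^n$, a linear polynomial $a_q(\xi-\xi_{ij})+b_q(\eta-\eta_{ij})+c_q$ ($(\xi_{ij},\eta_{ij})$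 the barycenter) preserving the three cell averages is formed; these are combined with weights proportional to $[(|a_q|^2+|b_q|^2)A_{ij}^n+10^{-6}]^{-2}$ normalized to sum to $1$; the result is evaluated at the Simpson points and transformed back. Put $$\omega_\ast^1=\sum_{\alpha=1}^3\sum_{\beta=2}^3\omega_\alpha\omega_\beta J_{ij}^{\alpha,\beta},\quad \omega_\ast^2=\sum_{\alpha=1}^2\sum_{\beta=1}^3\omega_\alpha\omega_\beta J_{ij}^{\alpha,\beta},\quad \omega_\ast^3=\sum_{\alpha=1}^3\sum_{\beta=1}^2\omega_\alpha\omega_\beta J_{ij}^{\alpha,\beta},\quad \omega_\ast^4=\sum_{\alpha=2}^3\sum_{\beta=1}^3\omega_\alpha\omega_\beta J_{ij}^{\alpha,\beta},$$ and define $$U_{1,ij}^{\ast\ast}=\frac1{\omega_\ast^1}\Big(\overline U_{ij}^nA_{ij}^n-\sum_{\alpha=1}^3\omega_\alpha\omega_1J_{ij}^{\alpha,1}U_{1,ij}^{\alpha,1}\Big),\qquad U_{2,ij}^{\ast\ast}=\frac1{\omega_\ast^2}\Big(\overline U_{ij}^nA_{ij}^n-\sum_{\alpha=1}^3\omega_3\omega_\alpha J_{ij}^{3,\alpha}U_{2,ij}^{3,\alpha}\Big),$$ $$U_{3,ij}^{\ast\ast}=\frac1{\omega_\ast^3}\Big(\overline U_{ij}^nA_{ij}^n-\sum_{\alpha=1}^3\omega_\alpha\omega_3J_{ij}^{\alpha,3}U_{3,ij}^{\alpha,3}\Big),\qquad U_{4,ij}^{\ast\ast}=\frac1{\omega_\ast^4}\Big(\overline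 U_{ij}^nA_{ij}^n-\sum_{\alpha=1}^3\omega_1\omega_\alpha J_{ij}^{1,\alpha}U_{4,ij}^{1,\alpha}\Big).$$ Mesh motion. Each vertex is moved by $\mathbf x^{n+1}=\mathbf x^n+\Delta t^n\mathbf u^n$, where $\mathbf u^n$ is the arithmetic mean, over the four edges meeting at the vertex, of the velocity with normal component $s^{\ast}$ (the HLLC contact speed for the two reconstructed limits at the vertex from the two sides of the edge) and tangential component $\frac12(u_\tau^{-}+u_\tau^{+})$ of those limits. $A_{ij}^{n+1}$ is the area of the moved cell at $t_{n+1}=t_n+\Delta t^n$.
   Formalization: In the time step restriction the maximum over 𝒫 also includes the outside values at the edges of each cell (with only the inside values the claim fails for a thin cold cell beside a hot one), and the one-sided limits are assumed to lie in G so that wave speeds and flux are defined. *)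

theory Defs
  imports "HOL-Analysis.Analysis"
begin

section \<open>Relativistic hydrodynamics in two space dimensions\<close>

text \<open>The conserved vector $U = (D, m_1, m_2, E)$.\<close>

type_synonym state = "real^4"

definition mom :: "state \<Rightarrow> real^2" where
  "mom U = vector [U $ 2, U $ 3]"

text \<open>Primitive variables are triples $(\rho, u, p)$.  The specific internal energy is eliminated by
  the equation of state $p = (\Gamma - 1) \rho e$.\<close>

definition lorentz :: "real^2 \<Rightarrow> real" where
  "lorentz u = 1 / sqrt (1 - (norm u)\<^sup>2)"

definition enthalpy :: "real \<Rightarrow> real \<Rightarrow> real \<Rightarrow> real" where
  "enthalpy \<Gamma> \<rho> p = (let e = p / ((\<Gamma> - 1) * \<rho>) in 1 + e + p / \<rho>)"

definition conserved :: "real \<Rightarrow> real \<times> (real^2) \<times> real \<Rightarrow> state" where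
  "conserved \<Gamma> = (\<lambda>(\<rho>, u, p).
     let D = \<rho> * lorentz u; w = D * enthalpy \<Gamma> \<rho> p * lorentz u
     in vector [D, w * u $ 1, w * u $ 2, w - p])"

definition prim_domain :: "(real \<times> (real^2) \<times> real) set" where
  "prim_domain = {(\<rho>, u, p). \<rho> > 0 \<and> p > 0 \<and> norm u < 1}"

definition admissible :: "real \<Rightarrow> state set" where
  "admissible \<Gamma> = conserved \<Gamma> ` prim_domain"

text \<open>The primitive variables of a conserved vector; they are meaningful on
  \<^term>\<open>admissible \<Gamma>\<close> only.\<close>

definition primitive :: "real \<Rightarrow> state \<Rightarrow> real \<times> (real^2) \<times> real" where
  "primitive \<Gamma> = inv_into prim_domain (conserved \<Gamma>)"

definition density :: "real \<Rightarrow> state \<Rightarrow> real" where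
  "density \<Gamma> U = fst (primitive \<Gamma> U)"

definition velocity :: "real \<Rightarrow> state \<Rightarrow> real^2" where
  "velocity \<Gamma> U = fst (snd (primitive \<Gamma> U))"

definition pressure :: "real \<Rightarrow> state \<Rightarrow> real" where
  "pressure \<Gamma> U = snd (snd (primitive \<Gamma> U))"

definition phys_flux :: "real \<Rightarrow> 2 \<Rightarrow> state \<Rightarrow> state" where
  "phys_flux \<Gamma> l U =
     (let u = velocity \<Gamma> U $ l; p = pressure \<Gamma> U
      in vector [U $ 1 * u, U $ 2 * u + p * axis l 1 $ 1, U $ 3 * u + p * axis l 1 $ 2, (U $ 4 + p) * u])"

text \<open>The frame of an edge: unit normal \<open>n\<close> and unit tangent \<open>tangent n\<close>.\<close>

definition tangent :: "real^2 \<Rightarrow> real^2" where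
  "tangent n = vector [- (n $ 2), n $ 1]"

definition rotate_to :: "real^2 \<Rightarrow> state \<Rightarrow> state" where
  "rotate_to n U = vector [U $ 1, mom U \<bullet> n, mom U \<bullet> tangent n, U $ 4]"

definition rotate_back :: "real^2 \<Rightarrow> state \<Rightarrow> state" where
  "rotate_back n V =
     (let m = (V $ 2) *\<^sub>R n + (V $ 3) *\<^sub>R tangent n in vector [V $ 1, m $ 1, m $ 2, V $ 4])"

subsection \<open>Wave speeds\<close>

definition sound_speed :: "real \<Rightarrow> state \<Rightarrow> real" where
  "sound_speed \<Gamma> U =
     (let \<rho> = density \<Gamma> U; p = pressure \<Gamma> U in sqrt (\<Gamma> * p / (\<rho> * enthalpy \<Gamma> \<rho> p)))"

definition sigma_s :: "real \<Rightarrow> state \<Rightarrow> real" where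
  "sigma_s \<Gamma> U =
     (sound_speed \<Gamma> U)\<^sup>2 / ((lorentz (velocity \<Gamma> U))\<^sup>2 * (1 - (sound_speed \<Gamma> U)\<^sup>2))"

definition s_min :: "real \<Rightarrow> real^2 \<Rightarrow> state \<Rightarrow> real" where
  "s_min \<Gamma> n U = (let un = velocity \<Gamma> U \<bullet> n; \<sigma> = sigma_s \<Gamma> U
     in (un - sqrt (\<sigma> * (1 - un\<^sup>2 + \<sigma>))) / (1 + \<sigma>))"

definition s_max :: "real \<Rightarrow> real^2 \<Rightarrow> state \<Rightarrow> real" where
  "s_max \<Gamma> n U = (let un = velocity \<Gamma> U \<bullet> n; \<sigma> = sigma_s \<Gamma> U
     in (un + sqrt (\<sigma> * (1 - un\<^sup>2 + \<sigma>))) / (1 + \<sigma>))"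

subsection \<open>The Lagrangian HLLC flux\<close>

text \<open>The arguments \<open>s\<close>, \<open>sm\<close>, \<open>sp\<close> are the left or right (\<open>hllc_A\<close>, \<open>hllc_B\<close>), the left and the
  right wave speed.\<close>

definition hllc_A :: "real^2 \<Rightarrow> real \<Rightarrow> state \<Rightarrow> real" where
  "hllc_A n s U = s * U $ 4 - mom U \<bullet> n"

definition hllc_B :: "real \<Rightarrow> real^2 \<Rightarrow> real \<Rightarrow> state \<Rightarrow> real" where
  "hllc_B \<Gamma> n s U = (mom U \<bullet> n) * (s - velocity \<Gamma> U \<bullet> n) - pressure \<Gamma> U"

text \<open>The contact speed is a root of $C_0 + C_1 s + C_2 s^2$.  The quadratic formula is $0/0$ or
  undefined for $C_2 = 0$ (this happens already for a uniform fluid at rest); the value there is the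
  root of the remaining linear equation, which is also the limit as $C_2 \to 0$ since $C_1 < 0$.\<close>

definition contact_speed :: "real \<Rightarrow> real^2 \<Rightarrow> real \<Rightarrow> real \<Rightarrow> state \<Rightarrow> state \<Rightarrow> real" where
  "contact_speed \<Gamma> n sm sp UL UR =
     (let AL = hllc_A n sm UL; AR = hllc_A n sp UR;
          BL = hllc_B \<Gamma> n sm UL; BR = hllc_B \<Gamma> n sp UR;
          C0 = BR - BL; C1 = AL + sp * BL - AR - sm * BR; C2 = sm * AR - sp * AL
      in if C2 = 0 then - C0 / C1
         else (- C1 - sqrt (C1\<^sup>2 - 4 * C0 * C2)) / (2 * C2))"

text \<open>That \<open>contact_speed\<close> is a root says exactly that the left-hand expression used here agrees with
  the corresponding right-hand one.\<close>

definition contact_pressure :: "real \<Rightarrow> real^2 \<Rightarrow> real \<Rightarrow> real \<Rightarrow> state \<Rightarrow> state \<Rightarrow> real" where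
  "contact_pressure \<Gamma> n sm sp UL UR =
     (let s = contact_speed \<Gamma> n sm sp UL UR
      in (s * hllc_A n sm UL - hllc_B \<Gamma> n sm UL) / (1 - sm * s))"

definition hllc_flux :: "real \<Rightarrow> real^2 \<Rightarrow> real \<Rightarrow> real \<Rightarrow> state \<Rightarrow> state \<Rightarrow> state" where
  "hllc_flux \<Gamma> n sm sp UL UR =
     (let s = contact_speed \<Gamma> n sm sp UL UR; p = contact_pressure \<Gamma> n sm sp UL UR
      in vector [0, p * n $ 1, p * n $ 2, p * s])"


section \<open>Quadrilateral meshes\<close>

text \<open>The vertex \<open>x i j\<close> is the corner of cell $(i,j)$ that belongs to $\hat x = \hat y = 1/2$, i.e.
  $x_{i+1/2,j+1/2}$.  Cells $1 \le i \le N_x$, $1 \le j \le N_y$ make up the computational domain;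
  they are surrounded by one layer of ghost cells ($i \in \{0, N_x + 1\}$ or
  $j \in \{0, N_y + 1\}$), which carry the boundary data.  Edge \<open>m\<close> is oriented by increasing
  $\hat x$ or $\hat y$, so that the two cells sharing an edge number its Simpson points alike.\<close>

type_synonym vertices = "int \<Rightarrow> int \<Rightarrow> real^2"

definition mesh_cells :: "int \<Rightarrow> int \<Rightarrow> (int \<times> int) set" where
  "mesh_cells Nx Ny = {1..Nx} \<times> {1..Ny}"

definition edge_start :: "vertices \<Rightarrow> int \<Rightarrow> int \<Rightarrow> nat \<Rightarrow> real^2" where
  "edge_start x i j m =
     (if m = 1 then x (i - 1) (j - 1) else if m = 2 then x i (j - 1)
      else if m = 3 then x (i - 1) j else x (i - 1) (j - 1))"

definition edge_end :: "vertices \<Rightarrow> int \<Rightarrow> int \<Rightarrow> nat \<Rightarrow> real^2" where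
  "edge_end x i j m =
     (if m = 1 then x i (j - 1) else if m = 2 then x i j
      else if m = 3 then x i j else x (i - 1) j)"

definition edge_length :: "vertices \<Rightarrow> int \<Rightarrow> int \<Rightarrow> nat \<Rightarrow> real" where
  "edge_length x i j m = dist (edge_start x i j m) (edge_end x i j m)"

definition simpson_node :: "nat \<Rightarrow> real" where
  "simpson_node \<alpha> = (if \<alpha> = 1 then - 1/2 else if \<alpha> = 2 then 0 else 1/2)"

definition simpson_weight :: "nat \<Rightarrow> real" where
  "simpson_weight \<alpha> = (if \<alpha> = 2 then 2/3 else 1/6)"

definition edge_point :: "vertices \<Rightarrow> int \<Rightarrow> int \<Rightarrow> nat \<Rightarrow> nat \<Rightarrow> real^2" where
  "edge_point x i j m \<alpha> =
     (1/2 - simpson_node \<alpha>) *\<^sub>R edge_start x i j m + (1/2 + simpson_node \<alpha>) *\<^sub>R edge_end x i j m"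

definition cell_loop :: "vertices \<Rightarrow> int \<Rightarrow> int \<Rightarrow> real \<Rightarrow> real^2" where
  "cell_loop x i j =
     linepath (x (i - 1) (j - 1)) (x i (j - 1)) +++ linepath (x i (j - 1)) (x i j) +++
     linepath (x i j) (x (i - 1) j) +++ linepath (x (i - 1) j) (x (i - 1) (j - 1))"

definition cell :: "vertices \<Rightarrow> int \<Rightarrow> int \<Rightarrow> (real^2) set" where
  "cell x i j = path_image (cell_loop x i j) \<union> inside (path_image (cell_loop x i j))"

definition cell_area :: "vertices \<Rightarrow> int \<Rightarrow> int \<Rightarrow> real" where
  "cell_area x i j = measure lebesgue (cell x i j)"

definition barycenter :: "vertices \<Rightarrow> int \<Rightarrow> int \<Rightarrow> real^2" where
  "barycenter x i j = (1 / cell_area x i j) *\<^sub>R integral (cell x i j) (\<lambda>y. y)"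

definition outward_normal :: "vertices \<Rightarrow> int \<Rightarrow> int \<Rightarrow> nat \<Rightarrow> real^2 \<Rightarrow> bool" where
  "outward_normal x i j m n \<longleftrightarrow>
     norm n = 1 \<and> n \<bullet> (edge_end x i j m - edge_start x i j m) = 0 \<and>
     (\<forall>\<^sub>F t in at_right 0. edge_point x i j m 2 + t *\<^sub>R n \<notin> cell x i j)"

subsection \<open>Coordinate transformations\<close>

definition ref_square :: "(real^2) set" where
  "ref_square = cbox (vector [- 1/2, - 1/2]) (vector [1/2, 1/2])"

definition ref_edge :: "nat \<Rightarrow> (real^2) set" where
  "ref_edge m = {z \<in> ref_square.
     if m = 1 then z $ 2 = - 1/2 else if m = 2 then z $ 1 = 1/2
     else if m = 3 then z $ 2 = 1/2 else z $ 1 = - 1/2}"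

definition ref_point :: "nat \<Rightarrow> nat \<Rightarrow> real^2" where
  "ref_point \<alpha> \<beta> = vector [simpson_node \<alpha>, simpson_node \<beta>]"

definition ref_edge_point :: "nat \<Rightarrow> nat \<Rightarrow> real^2" where
  "ref_edge_point m \<alpha> =
     (if m = 1 then ref_point \<alpha> 1 else if m = 2 then ref_point 3 \<alpha>
      else if m = 3 then ref_point \<alpha> 3 else ref_point 1 \<alpha>)"

definition jac :: "(real^2 \<Rightarrow> real^2) \<Rightarrow> nat \<Rightarrow> nat \<Rightarrow> real" where
  "jac \<phi> \<alpha> \<beta> = \<bar>det (jacobian \<phi> (at (ref_point \<alpha> \<beta>) within ref_square))\<bar>"

text \<open>The bilinear map onto a convex quadrilateral is an example.\<close>

definition coord_transformation ::
    "vertices \<Rightarrow> int \<Rightarrow> int \<Rightarrow> (real^2 \<Rightarrow> real^2) \<Rightarrow> bool" where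
  "coord_transformation x i j \<phi> \<longleftrightarrow>
     bij_betw \<phi> ref_square (cell x i j) \<and>
     \<phi> differentiable_on ref_square \<and>
     (\<forall>z\<in>ref_square. det (jacobian \<phi> (at z within ref_square)) \<noteq> 0) \<and>
     (\<forall>m\<in>{1..4}. \<phi> ` ref_edge m = closed_segment (edge_start x i j m) (edge_end x i j m)) \<and>
     (\<forall>m\<in>{1..4}. \<forall>\<alpha>\<in>{1..3}. \<phi> (ref_edge_point m \<alpha>) = edge_point x i j m \<alpha>)"

definition quad_mesh ::
    "int \<Rightarrow> int \<Rightarrow> vertices \<Rightarrow> (int \<Rightarrow> int \<Rightarrow> nat \<Rightarrow> real^2) \<Rightarrow>
     (int \<Rightarrow> int \<Rightarrow> real^2 \<Rightarrow> real^2) \<Rightarrow> bool" where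
  "quad_mesh Nx Ny x nrm \<phi> \<longleftrightarrow>
     (\<forall>i\<in>{0..Nx+1}. \<forall>j\<in>{0..Ny+1}. simple_path (cell_loop x i j) \<and>
        (\<forall>m\<in>{1..4}. outward_normal x i j m (nrm i j m))) \<and>
     (\<forall>(i, j)\<in>mesh_cells Nx Ny. coord_transformation x i j (\<phi> i j)) \<and>
     (\<forall>(i, j)\<in>mesh_cells Nx Ny. \<forall>(k, l)\<in>mesh_cells Nx Ny.
        (i, j) \<noteq> (k, l) \<longrightarrow> interior (cell x i j) \<inter> interior (cell x k l) = {})"


section \<open>Reconstruction\<close>

text \<open>Inside limits are given as a function \<open>Um\<close> of $i$, $j$, $m$, $\alpha$.  The outside limit at an
  edge is the inside limit of the cell on its other side; for an edge on the boundary of the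
  domain that is a ghost cell.\<close>

type_synonym limits = "int \<Rightarrow> int \<Rightarrow> nat \<Rightarrow> nat \<Rightarrow> state"

definition outer :: "limits \<Rightarrow> limits" where
  "outer Um i j m \<alpha> =
     (if m = 1 then Um i (j - 1) 3 \<alpha> else if m = 2 then Um (i + 1) j 4 \<alpha>
      else if m = 3 then Um i (j + 1) 1 \<alpha> else Um (i - 1) j 2 \<alpha>)"

definition left_eigenvector_matrix :: "real^4^4 \<Rightarrow> real^4^4 \<Rightarrow> bool" where
  "left_eigenvector_matrix L A \<longleftrightarrow>
     invertible L \<and> (\<forall>k. \<exists>\<mu>. (L $ k) v* A = \<mu> *s (L $ k))"

text \<open>A stencil is a pair of signs: $(s,t)$ stands for the cells $(i,j)$, $(i+s,j)$, $(i,j+t)$.\<close>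

definition stencils :: "(int \<times> int) set" where
  "stencils = {- 1, 1} \<times> {- 1, 1}"

definition local_linear ::
    "real^2 \<Rightarrow> real^2 \<Rightarrow> state \<Rightarrow> state \<Rightarrow> state \<Rightarrow> real^2 \<Rightarrow> state" where
  "local_linear n y0 a b c y =
     (y \<bullet> n - y0 \<bullet> n) *\<^sub>R a + (y \<bullet> tangent n - y0 \<bullet> tangent n) *\<^sub>R b + c"

text \<open>The reconstruction is carried out for each characteristic variable separately, hence the
  coefficients are vectors and the nonlinear weights depend on the component \<open>k\<close>.\<close>

definition weno_indicator :: "real \<Rightarrow> state \<Rightarrow> state \<Rightarrow> 4 \<Rightarrow> real" where
  "weno_indicator area a b k =
     1 / ((\<bar>a $ k\<bar>\<^sup>2 + \<bar>b $ k\<bar>\<^sup>2) * area + 1 / 10 ^ 6)\<^sup>2"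

text \<open>The left eigenvectors are determined up to normalization only; any choice is allowed.\<close>

definition weno_limits ::
    "real \<Rightarrow> vertices \<Rightarrow> (int \<Rightarrow> int \<Rightarrow> state) \<Rightarrow> int \<Rightarrow> int \<Rightarrow> nat \<Rightarrow> real^2 \<Rightarrow>
     (nat \<Rightarrow> state) \<Rightarrow> bool" where
  "weno_limits \<Gamma> x Ub i j m n V \<longleftrightarrow>
     (\<exists>L a b c.
        left_eigenvector_matrix L (jacobian (phys_flux \<Gamma> 1) (at (rotate_to n (Ub i j)))) \<and>
        (\<forall>(s, t)\<in>stencils. \<forall>(k, l)\<in>{(i, j), (i + s, j), (i, j + t)}.
           (local_linear n (barycenter x i j) (a (s, t)) (b (s, t)) (c (s, t)) has_integral
              cell_area x k l *\<^sub>R (L *v rotate_to n (Ub k l))) (cell x k l)) \<and>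
        (\<forall>\<alpha>\<in>{1..3}. V \<alpha> = rotate_back n (matrix_inv L *v
           (\<chi> k. \<Sum>q\<in>stencils.
              weno_indicator (cell_area x i j) (a q) (b q) k /
              (\<Sum>r\<in>stencils. weno_indicator (cell_area x i j) (a r) (b r) k) *
              local_linear n (barycenter x i j) (a q) (b q) (c q) (edge_point x i j m \<alpha>) $ k))))"

definition omega_star :: "(real^2 \<Rightarrow> real^2) \<Rightarrow> nat \<Rightarrow> real" where
  "omega_star \<phi> m =
     (let w = simpson_weight in
      if m = 1 then \<Sum>\<alpha>=1..3. \<Sum>\<beta>=2..3. w \<alpha> * w \<beta> * jac \<phi> \<alpha> \<beta>
      else if m = 2 then \<Sum>\<alpha>=1..2. \<Sum>\<beta>=1..3. w \<alpha> * w \<beta> * jac \<phi> \<alpha> \<beta>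
      else if m = 3 then \<Sum>\<alpha>=1..3. \<Sum>\<beta>=1..2. w \<alpha> * w \<beta> * jac \<phi> \<alpha> \<beta>
      else \<Sum>\<alpha>=2..3. \<Sum>\<beta>=1..3. w \<alpha> * w \<beta> * jac \<phi> \<alpha> \<beta>)"

text \<open>\<open>edge_jac \<phi> m \<alpha>\<close> is the Jacobian at the \<open>\<alpha>\<close>-th Simpson point of edge \<open>m\<close>.\<close>

definition edge_jac :: "(real^2 \<Rightarrow> real^2) \<Rightarrow> nat \<Rightarrow> nat \<Rightarrow> real" where
  "edge_jac \<phi> m \<alpha> =
     (if m = 1 then jac \<phi> \<alpha> 1 else if m = 2 then jac \<phi> 3 \<alpha>
      else if m = 3 then jac \<phi> \<alpha> 3 else jac \<phi> 1 \<alpha>)"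

text \<open>The weight \<open>simpson_weight 1\<close> is the one in the direction across the edge; for edges 2 and 3
  it is literally $\omega_3 = \omega_1$.\<close>

definition U_star_star ::
    "vertices \<Rightarrow> (int \<Rightarrow> int \<Rightarrow> real^2 \<Rightarrow> real^2) \<Rightarrow> (int \<Rightarrow> int \<Rightarrow> state) \<Rightarrow> limits \<Rightarrow>
     int \<Rightarrow> int \<Rightarrow> nat \<Rightarrow> state" where
  "U_star_star x \<phi> Ub Um i j m =
     (1 / omega_star (\<phi> i j) m) *\<^sub>R
       (cell_area x i j *\<^sub>R Ub i j -
        (\<Sum>\<alpha>=1..3. (simpson_weight \<alpha> * simpson_weight 1 * edge_jac (\<phi> i j) m \<alpha>) *\<^sub>R Um i j m \<alpha>))"


section \<open>The scheme\<close>

text \<open>\<open>sm\<close> and \<open>sp\<close> are the estimators of the left and right HLLC wave speeds.\<close>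

type_synonym speed_estimate = "real^2 \<Rightarrow> state \<Rightarrow> state \<Rightarrow> real"

definition edge_velocity ::
    "real \<Rightarrow> speed_estimate \<Rightarrow> speed_estimate \<Rightarrow> real^2 \<Rightarrow> state \<Rightarrow> state \<Rightarrow> real^2" where
  "edge_velocity \<Gamma> sm sp n UL UR =
     contact_speed \<Gamma> n (sm n UL UR) (sp n UL UR) UL UR *\<^sub>R n +
     (1/2 * (velocity \<Gamma> UL \<bullet> tangent n + velocity \<Gamma> UR \<bullet> tangent n)) *\<^sub>R tangent n"

text \<open>The four edges meeting at vertex $x_{i+1/2,j+1/2}$ are: edge 2 of cell $(i,j)$ (upper end),
  edge 2 of $(i,j+1)$ (lower end), edge 3 of $(i,j)$ (right end), edge 3 of $(i+1,j)$ (left end).\<close>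

definition vertex_velocity ::
    "real \<Rightarrow> speed_estimate \<Rightarrow> speed_estimate \<Rightarrow> (int \<Rightarrow> int \<Rightarrow> nat \<Rightarrow> real^2) \<Rightarrow> limits \<Rightarrow>
     int \<Rightarrow> int \<Rightarrow> real^2" where
  "vertex_velocity \<Gamma> sm sp nrm Um i j =
     (let v = (\<lambda>k l m \<alpha>. edge_velocity \<Gamma> sm sp (nrm k l m) (Um k l m \<alpha>) (outer Um k l m \<alpha>))
      in (1/4) *\<^sub>R (v i j 2 3 + v i (j + 1) 2 1 + v i j 3 3 + v (i + 1) j 3 1))"

definition moved ::
    "real \<Rightarrow> speed_estimate \<Rightarrow> speed_estimate \<Rightarrow> vertices \<Rightarrow> (int \<Rightarrow> int \<Rightarrow> nat \<Rightarrow> real^2) \<Rightarrow>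
     limits \<Rightarrow> real \<Rightarrow> vertices" where
  "moved \<Gamma> sm sp x nrm Um dt i j = x i j + dt *\<^sub>R vertex_velocity \<Gamma> sm sp nrm Um i j"

definition euler_step ::
    "real \<Rightarrow> speed_estimate \<Rightarrow> speed_estimate \<Rightarrow> vertices \<Rightarrow> (int \<Rightarrow> int \<Rightarrow> nat \<Rightarrow> real^2) \<Rightarrow>
     limits \<Rightarrow> real \<Rightarrow> (int \<Rightarrow> int \<Rightarrow> state) \<Rightarrow> int \<Rightarrow> int \<Rightarrow> state \<Rightarrow> bool" where
  "euler_step \<Gamma> sm sp x nrm Um dt Ub i j Unew \<longleftrightarrow>
     cell_area (moved \<Gamma> sm sp x nrm Um dt) i j *\<^sub>R Unew =
     cell_area x i j *\<^sub>R Ub i j -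
     dt *\<^sub>R (\<Sum>m=1..4. \<Sum>\<alpha>=1..3.
       (simpson_weight \<alpha> * edge_length x i j m) *\<^sub>R
         (let n = nrm i j m; UL = Um i j m \<alpha>; UR = outer Um i j m \<alpha>
          in hllc_flux \<Gamma> n (sm n UL UR) (sp n UL UR) UL UR))"

subsection \<open>Quantities of the time step restriction\<close>

definition J_cell :: "(real^2 \<Rightarrow> real^2) \<Rightarrow> real" where
  "J_cell \<phi> = Min {edge_jac \<phi> m \<alpha> | m \<alpha>. m \<in> {1..4} \<and> \<alpha> \<in> {1..3}}"

definition perimeter :: "vertices \<Rightarrow> int \<Rightarrow> int \<Rightarrow> real" where
  "perimeter x i j = (\<Sum>m=1..4. edge_length x i j m)"

text \<open>The elements $W_{ij}^\alpha$ of $\mathcal P$, each paired with the edge normal with respect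
  to which its wave speeds are taken.  Both one-sided limits at the \<open>\<alpha>\<close>-th Simpson points of the
  four edges of cell $(i,j)$ are included: the outside limits are the inside limits of the
  neighboring cells (replacing \<open>n\<close> by \<open>- n\<close> only swaps $|s_{\min}|$ and $|s_{\max}|$), and their
  speeds enter $s^\pm$ at the edges of cell $(i,j)$.\<close>

definition edge_values ::
    "(int \<Rightarrow> int \<Rightarrow> nat \<Rightarrow> real^2) \<Rightarrow> limits \<Rightarrow> int \<Rightarrow> int \<Rightarrow> nat \<Rightarrow> ((real^2) \<times> state) set" where
  "edge_values nrm Um i j \<alpha> =
     (\<Union>m\<in>{1..4}. {(nrm i j m, Um i j m \<alpha>), (nrm i j m, outer Um i j m \<alpha>)})"

definition max_speed :: "real \<Rightarrow> ((real^2) \<times> state) set \<Rightarrow> real" where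
  "max_speed \<Gamma> P = Max ((\<lambda>(n, W). max \<bar>s_min \<Gamma> n W\<bar> \<bar>s_max \<Gamma> n W\<bar>) ` P)"

end

theory Submission
  imports Defs
begin

text \<open>
  The admissible set is the open convex cone $D > 0$, $E > |(D, \mathbf m)|$, so the area of the moved
  cell is irrelevant: it is nonzero because the right-hand side of the scheme lies in the cone, and
  then one divides by it.  That right-hand side is the sum over the edges of
  $\frac14 \omega_*^m U_m^{**}$ and of terms $c\,U - \mu \widehat F$ at the Simpson points.  With
  $F(U) = u_n U + (0, p\,\mathbf n, p\,u_n)$ one has
  $c\,U - \mu \widehat F = \mu (F(U) - s^- U - \widehat F) + ((c + \mu s^-) U - \mu F(U))$.
  The first bracket is a multiple of the state behind the left wave; in a frame
  moving with the contact its admissibility reduces to completing a square, using only that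
  $(u_n - s^-)^2 \ge \sigma_s (1 - (s^-)^2)$ and $|s^*| < 1$, not the sign of $p^*$.  The second one is
  the same statement for the reflected problem with $p^* = 0$.  That $s^*$ lies between $s^-$
  and $s^+$ follows from the signs of the quadratic $C_0 + C_1 s + C_2 s^2$ at $s^\pm$.
\<close>

section \<open>Real inequalities for one normal direction: star state, wave fan, contact quadratic,
  characteristic speeds\<close>

section \<open>Scalar inequalities\<close>

lemma mult_less_one_abs:
  fixes c d :: real
  assumes "\<bar>c\<bar> < 1" "\<bar>d\<bar> < 1"
  shows "c * d < 1"
proof -
  have "\<bar>c\<bar> * \<bar>d\<bar> < 1 * 1" using assms by (intro mult_strict_mono') auto
  then show ?thesis by (simp add: abs_mult[symmetric])
qed

text \<open>Scalar core of \<open>star_state_admissible\<close>. There \<open>g\<close> is 1/h,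
  \<open>W\<close> is 1 - |v|^2 for the full velocity, \<open>w\<close> is E + p of the given state
  and \<open>c2\<close> its squared sound speed; \<open>W \<le> 1 - u\<^sup>2\<close> leaves room
  for a tangential velocity. On the left of the last inequality stand the squares of the normal
  momentum, the tangential momentum and the mass of the vector whose energy is
  \<open>E\<close>.\<close>

lemma star_state_real:
  fixes \<Gamma> g W w p u a s sL P k E c2 :: real
  assumes \<Gamma>: "1 < \<Gamma>" "\<Gamma> \<le> 2" and g: "0 < g" "g < 1" and W: "0 < W" "W \<le> 1 - u\<^sup>2" and w: "0 < w"
    and p: "p = (\<Gamma> - 1) / \<Gamma> * (1 - g) * W * w"
    and c2: "c2 = (\<Gamma> - 1) * (1 - g)"
    and sL: "- 1 < sL" "sL < u" "u < 1" and s: "\<bar>s\<bar> < 1"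
    and char: "c2 * W * (1 - sL\<^sup>2) \<le> (1 - c2) * (u - sL)\<^sup>2"
    and k: "k = w * (u - sL)"
    and P: "(P - p) * (1 - sL * s) = k * (u - s)"
    and E: "E = (u - sL) * (w - p) - (P * s - p * u)"
  shows "0 < E" and "(k * u - (P - p))\<^sup>2 + k\<^sup>2 * (1 - W - u\<^sup>2) + k\<^sup>2 * W * g\<^sup>2 < E\<^sup>2"
proof -
  \<comment> \<open>\<open>x\<close>, \<open>b\<close>, \<open>y\<close> are the factors 1 -
    (product of velocities) of relativistic velocity addition. The inequality to be proved becomes
    positivity of a quadratic form in \<open>s - u\<close> and \<open>x\<close>; \<open>disc\<close>
    below makes that form definite.\<close>
  define x where "x = 1 - sL * s"
  define b where "b = 1 - u * sL"
  define y where "y = 1 - sL\<^sup>2"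
  define \<epsilon> where "\<epsilon> = p / k"
  define K where "K = 1 - g\<^sup>2 - 2 * c2 / \<Gamma>"
  have abs_sL: "\<bar>sL\<bar> < 1" and abs_u: "\<bar>u\<bar> < 1" using sL by auto
  have x0: "0 < x" using mult_less_one_abs[OF abs_sL s] by (simp add: x_def)
  have b0: "0 < b" using mult_less_one_abs[OF abs_u abs_sL] by (simp add: b_def)
  have y0: "0 < y" using abs_sL by (simp add: y_def abs_square_less_1)
  have s1: "0 < 1 - s\<^sup>2" using s by (simp add: abs_square_less_1)
  have k0: "0 < k" using w sL by (simp add: k)
  have a0: "0 < u - sL" using sL by simp
  have pk: "p = k * \<epsilon>" using k0 by (simp add: \<epsilon>_def)
  have \<epsilon>a: "\<epsilon> * (u - sL) = c2 / \<Gamma> * W"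
    using w a0 \<Gamma> by (simp add: \<epsilon>_def k p c2 field_simps)
  have c2_pos: "0 < c2" using \<Gamma> g by (simp add: c2)
  have K_eq: "K = (1 - g) * (g + (2 - \<Gamma>) / \<Gamma>)"
    using \<Gamma> by (simp add: K_def c2 field_simps power2_eq_square)
  \<comment> \<open>Both sides carry the factor \<open>1 - g\<close>. What remains is compared
    coefficient by coefficient, with \<open>\<Gamma> - 1\<close> replaced by
    \<open>\<Gamma>\<close>; \<open>\<Gamma> \<le> 2\<close> gives \<open>2 - \<Gamma>\<close> the
    right sign.\<close>
  have "c2 * (1 - c2) / \<Gamma>\<^sup>2 < K"
  proof -
    have "c2 * (1 - c2) = (1 - g) * ((\<Gamma> - 1) * (2 - \<Gamma>) + (\<Gamma> - 1)\<^sup>2 * g)"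
      by (simp add: c2 algebra_simps power2_eq_square)
    also have "\<dots> < (1 - g) * (\<Gamma> * (2 - \<Gamma>) + \<Gamma>\<^sup>2 * g)"
    proof (intro mult_strict_left_mono add_le_less_mono)
      show "(\<Gamma> - 1) * (2 - \<Gamma>) \<le> \<Gamma> * (2 - \<Gamma>)" using \<Gamma> by (intro mult_right_mono) auto
      show "(\<Gamma> - 1)\<^sup>2 * g < \<Gamma>\<^sup>2 * g" using \<Gamma> g by (intro mult_strict_right_mono power_strict_mono) auto
    qed (use g in auto)
    also have "\<dots> = \<Gamma>\<^sup>2 * K" using \<Gamma> by (simp add: K_eq field_simps power2_eq_square)
    finally show ?thesis using \<Gamma> by (simp add: field_simps)
  qed
  then have "W * (c2 * (1 - c2) / \<Gamma>\<^sup>2) < W * K" using mult_strict_left_mono W(1) by blast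
  \<comment> \<open>The wave speed condition \<open>char\<close> enters here: by
    \<open>\<epsilon>a\<close> the product \<open>\<epsilon> * (u - sL)\<close> is independent of
    \<open>sL\<close>, so only \<open>y / (u - sL)\<^sup>2\<close> has to be bounded.\<close>
  moreover have "\<epsilon>\<^sup>2 * y \<le> W * (c2 * (1 - c2) / \<Gamma>\<^sup>2)"
  proof -
    have "\<epsilon>\<^sup>2 * y * (u - sL)\<^sup>2 = (c2 / \<Gamma> * W)\<^sup>2 * y" using \<epsilon>a
      by (simp add: power_mult_distrib[symmetric] mult.commute mult.left_commute)
    also have "\<dots> = c2 * W / \<Gamma>\<^sup>2 * (c2 * W * y)" by (simp add: power2_eq_square)
    also have "\<dots> \<le> c2 * W / \<Gamma>\<^sup>2 * ((1 - c2) * (u - sL)\<^sup>2)"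
      using char c2_pos W by (intro mult_left_mono) (auto simp: y_def)
    finally have "\<epsilon>\<^sup>2 * y * (u - sL)\<^sup>2 \<le> W * (c2 * (1 - c2) / \<Gamma>\<^sup>2) * (u - sL)\<^sup>2"
      by (simp add: mult_ac)
    then show ?thesis using a0 mult_le_cancel_right_pos[of "(u - sL)\<^sup>2"] by (metis zero_less_power)
  qed
  ultimately have disc: "\<epsilon>\<^sup>2 * y < W * K" by linarith
  \<comment> \<open>This square is the claim up to the factor $k^2 / x^2$, with $E^2$ lowered to $E^2 - q^2$; the
    lowered inequality is the one that is invariant under boosts along the normal.\<close>
  have "0 < y * (s - u - \<epsilon> * x)\<^sup>2 + x\<^sup>2 * (W * K - \<epsilon>\<^sup>2 * y)"
    using y0 x0 disc by (intro add_nonneg_pos mult_pos_pos) auto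
  also have "\<dots> = (s - u)\<^sup>2 * y + x\<^sup>2 * W * (1 - g\<^sup>2) - 2 * x\<^sup>2 * (c2 / \<Gamma> * W) - 2 * \<epsilon> * x * (s - u) * y"
    by (simp add: K_def algebra_simps power2_eq_square)
  \<comment> \<open>The last two terms merge by
    \<open>x * (u - sL) + (s - u) * y = b * (s - sL)\<close>.\<close>
  also have "\<dots> = (s - u)\<^sup>2 * y + x\<^sup>2 * W * (1 - g\<^sup>2) - 2 * \<epsilon> * x * (b * (s - sL))"
    unfolding \<epsilon>a[symmetric] by (simp add: x_def b_def y_def algebra_simps power2_eq_square)
  also have "(s - u)\<^sup>2 * y = b\<^sup>2 * (1 - s\<^sup>2) - 2 * b * (s - sL) * (u - s) - x\<^sup>2 * (1 - u\<^sup>2)"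
    by (simp add: x_def b_def y_def algebra_simps power2_eq_square)
  finally have core: "x\<^sup>2 * (1 - u\<^sup>2 - W * (1 - g\<^sup>2))
      < b * (b * (1 - s\<^sup>2) - 2 * (s - sL) * (\<epsilon> * x + (u - s)))"
    by (simp add: algebra_simps power2_eq_square)
  \<comment> \<open>For a star state with energy e, \<open>E\<close> is (s - sL) e, \<open>q\<close>
    is (s - sL) P and \<open>H\<close> is (s - sL) (e + P). The facts \<open>EH\<close> and
    \<open>M\<close> below are then E = H - q and the relation m = (e + P) s for its normal
    momentum.\<close>
  define H where "H = k * b / x"
  define q where "q = P * (s - sL)"
  define T where "T = 1 - u\<^sup>2 - W * (1 - g\<^sup>2)"
  have Px: "P * x = k * \<epsilon> * x + k * (u - s)"
    using P pk by (simp add: x_def algebra_simps)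
  have xH: "x * H = k * b" using x0 by (simp add: H_def)
  have H0: "0 < H" using k0 b0 x0 by (simp add: H_def)
  have "x\<^sup>2 * (k\<^sup>2 * T) = k\<^sup>2 * (x\<^sup>2 * T)" by simp
  also have "\<dots> < k\<^sup>2 * (b * (b * (1 - s\<^sup>2) - 2 * (s - sL) * (\<epsilon> * x + (u - s))))"
    using core k0 by (simp add: T_def)
  also have "\<dots> = (k * b) * ((k * b) * (1 - s\<^sup>2) - 2 * (s - sL) * (P * x))"
    unfolding Px by (simp add: algebra_simps power2_eq_square)
  also have "\<dots> = x\<^sup>2 * (H * (H * (1 - s\<^sup>2) - 2 * q))"
    unfolding xH[symmetric] q_def by (simp add: algebra_simps power2_eq_square)
  finally have main: "k\<^sup>2 * T < H * (H * (1 - s\<^sup>2) - 2 * q)"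
    using x0 by simp
  \<comment> \<open>\<open>k\<^sup>2 * T\<close> is squared mass plus squared tangential momentum.
    Its sign turns \<open>main\<close> into an upper bound on \<open>q\<close>, from which the sign
    of \<open>E\<close> follows.\<close>
  have T0: "0 \<le> T"
  proof -
    have "W * (1 - g\<^sup>2) \<le> W * 1" using W by (intro mult_left_mono) auto
    moreover have "\<dots> \<le> 1 - u\<^sup>2" using W by simp
    ultimately show ?thesis unfolding T_def by linarith
  qed
  have "x * (k * u - (P - p)) = k * u * x - k * (u - s)" using P by (simp add: x_def algebra_simps)
  also have "\<dots> = x * (s * H)" unfolding mult.left_commute[of x s] xH by (simp add: x_def b_def algebra_simps)
  finally have M: "k * u - (P - p) = s * H" using x0 by simp
  have "x * (E + q) = (k - p * (u - sL)) * x + p * u * x - (P * x) * sL"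
    by (simp add: E k q_def algebra_simps)
  also have "\<dots> = x * H" unfolding Px xH pk
    by (simp add: x_def b_def algebra_simps)
  finally have "E + q = H" using x0 by simp
  then have EH: "E = H - q" by simp
  have "0 \<le> k\<^sup>2 * T" using T0 by simp
  with main have "0 < H * (H * (1 - s\<^sup>2) - 2 * q)" by linarith
  then have q: "2 * q < H * (1 - s\<^sup>2)" using H0 by (simp add: zero_less_mult_iff)
  have "H * (1 - s\<^sup>2) \<le> H * 1" using H0 by (intro mult_left_mono) auto
  with q H0 show "0 < E" unfolding EH by linarith
  have "(k * u - (P - p))\<^sup>2 + k\<^sup>2 * (1 - W - u\<^sup>2) + k\<^sup>2 * W * g\<^sup>2 = s\<^sup>2 * H\<^sup>2 + k\<^sup>2 * T"
    unfolding M by (simp add: T_def algebra_simps power2_eq_square)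
  also have "\<dots> < s\<^sup>2 * H\<^sup>2 + H * (H * (1 - s\<^sup>2) - 2 * q) + q\<^sup>2" using main zero_le_power2[of q] by linarith
  also have "\<dots> = E\<^sup>2" unfolding EH by (simp add: algebra_simps power2_eq_square)
  finally show "(k * u - (P - p))\<^sup>2 + k\<^sup>2 * (1 - W - u\<^sup>2) + k\<^sup>2 * W * g\<^sup>2 < E\<^sup>2" .
qed

text \<open>\<open>a\<close> and \<open>r\<close> are the distances from \<open>u\<close> to a speed
  on its left and one on its right. In their reciprocals the two characteristic conditions are
  quadratics with the same leading coefficient; averaging them and completing a square reduces the
  claim to \<open>1 + c2 < \<Gamma>\<close>.\<close>

lemma wave_fan_real:
  fixes \<Gamma> c2 W u a r :: real
  assumes \<Gamma>: "1 < \<Gamma>" and c2: "0 < c2" "c2 < \<Gamma> - 1" "c2 < 1" and W: "0 < W" "W \<le> 1 - u\<^sup>2"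
    and a: "0 < a" and r: "0 < r"
    and char_a: "c2 * W * (1 - (u - a)\<^sup>2) \<le> (1 - c2) * a\<^sup>2"
    and char_r: "c2 * W * (1 - (u + r)\<^sup>2) \<le> (1 - c2) * r\<^sup>2"
  shows "c2 / \<Gamma> * W * (1 - (u - a) * (u + r)) < r * a"
proof -
  define A where "A = 1 / a"
  define R where "R = 1 / r"
  define z where "z = 1 - u\<^sup>2"
  define t where "t = c2 * W"
  have t0: "0 < t" using c2 W by (simp add: t_def)
  have z0: "0 < z" using W by (simp add: z_def)
  have aA: "a * A = 1" and rR: "r * R = 1" using a r by (auto simp: A_def R_def)
  have "t * (1 - (u - a)\<^sup>2) * A\<^sup>2 \<le> (1 - c2) * a\<^sup>2 * A\<^sup>2"
    using char_a by (intro mult_right_mono) (auto simp: t_def)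
  moreover have "(1 - (u - a)\<^sup>2) * A\<^sup>2 = z * A\<^sup>2 + 2 * u * (a * A) * A - (a * A)\<^sup>2"
    by (simp add: z_def algebra_simps power2_eq_square)
  ultimately have 1: "t * (z * A\<^sup>2 + 2 * u * A - 1) \<le> 1 - c2"
    using aA by (simp add: mult.assoc power_mult_distrib[symmetric])
  have "t * (1 - (u + r)\<^sup>2) * R\<^sup>2 \<le> (1 - c2) * r\<^sup>2 * R\<^sup>2"
    using char_r by (intro mult_right_mono) (auto simp: t_def)
  moreover have "(1 - (u + r)\<^sup>2) * R\<^sup>2 = z * R\<^sup>2 - 2 * u * (r * R) * R - (r * R)\<^sup>2"
    by (simp add: z_def algebra_simps power2_eq_square)
  ultimately have 2: "t * (z * R\<^sup>2 - 2 * u * R - 1) \<le> 1 - c2"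
    using rR by (simp add: mult.assoc power_mult_distrib[symmetric])
  define d where "d = A - R"
  \<comment> \<open>The mean of the two bounds, with
    \<open>A\<^sup>2 + R\<^sup>2 = 2 * A * R + d\<^sup>2\<close>.\<close>
  have 3: "t * (z * A * R + z * d\<^sup>2 / 2 + u * d - 1) \<le> 1 - c2"
  proof -
    have "t * (z * A * R + z * d\<^sup>2 / 2 + u * d - 1)
        = (t * (z * A\<^sup>2 + 2 * u * A - 1) + t * (z * R\<^sup>2 - 2 * u * R - 1)) / 2"
      by (simp add: d_def field_simps power2_eq_square)
    also have "\<dots> \<le> ((1 - c2) + (1 - c2)) / 2"
      using 1 2 by (intro divide_right_mono add_mono) auto
    finally show ?thesis by simp
  qed
  \<comment> \<open>The goal contains \<open>- u * d\<close> where the mean contains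
    \<open>u * d\<close>. The difference \<open>2 * u * d\<close> is absorbed by
    \<open>z * d\<^sup>2 / 2\<close> at the cost of \<open>2 * u\<^sup>2 / z\<close>.\<close>
  have "0 \<le> (z * d + 2 * u)\<^sup>2" by simp
  then have "- (4 * u\<^sup>2) \<le> z * (z * d\<^sup>2 + 4 * u * d)" by (simp add: algebra_simps power2_eq_square)
  then have "- (2 * u\<^sup>2 / z) \<le> z * d\<^sup>2 / 2 + 2 * u * d" using z0 by (simp add: field_simps)
  then have "t * (z * A * R - u * d + 1) \<le> t * (z * A * R + z * d\<^sup>2 / 2 + u * d - 1 + (2 + 2 * u\<^sup>2 / z))"
    using t0 by (intro mult_left_mono) linarith+
  also have "\<dots> \<le> 1 - c2 + t * (2 + 2 * u\<^sup>2 / z)"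
    unfolding distrib_left[of t _ "2 + _"] using 3 by (intro add_right_mono)
  also have "2 + 2 * u\<^sup>2 / z = 2 / z" using z0 by (simp add: z_def field_simps)
  also have "t * (2 / z) \<le> 2 * c2"
    using mult_left_mono[of W z c2] W c2 z0 by (simp add: t_def z_def[symmetric] field_simps)
  also have "1 - c2 + 2 * c2 < \<Gamma>" using c2 by simp
  finally have "t * (z * A * R - u * d + 1) < \<Gamma>" by simp
  then have "t * (z * A * R - u * d + 1) * (a * r) < \<Gamma> * (a * r)" using a r by simp
  moreover have "(z * A * R - u * d + 1) * (a * r) = z * (a * A) * (r * R) - u * (a * A) * r + u * (r * R) * a + a * r"
    by (simp add: d_def algebra_simps)
  then have "(z * A * R - u * d + 1) * (a * r) = 1 - (u - a) * (u + r)"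
    unfolding aA rR by (simp add: z_def algebra_simps power2_eq_square)
  ultimately have "t * (1 - (u - a) * (u + r)) < \<Gamma> * (a * r)" by (simp add: mult.assoc)
  then show ?thesis using \<Gamma> by (simp add: t_def field_simps)
qed

text \<open>The quadratic crosses zero downwards between \<open>a\<close> and \<open>b\<close>. The
  minus sign before the square root selects the root at which the derivative
  \<open>C1 + 2 * C2 * r\<close> is negative, whatever the sign of \<open>C2\<close>.\<close>

lemma quadratic_root_between:
  fixes a b C0 C1 C2 :: real
  assumes ab: "a < b" and Qa: "0 < C0 + C1 * a + C2 * a\<^sup>2" and Qb: "C0 + C1 * b + C2 * b\<^sup>2 < 0"
  defines "r \<equiv> (if C2 = 0 then - C0 / C1 else (- C1 - sqrt (C1\<^sup>2 - 4 * C0 * C2)) / (2 * C2))"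
  shows "a < r" "r < b" "C0 + C1 * r + C2 * r\<^sup>2 = 0"
proof -
  have "\<exists>t. a \<le> t \<and> t \<le> b \<and> C0 + C1 * t + C2 * t\<^sup>2 = 0"
    using ab Qa Qb by (intro IVT2') (auto intro!: continuous_intros)
  then obtain t where t: "a \<le> t" "t \<le> b" "C0 + C1 * t + C2 * t\<^sup>2 = 0" by blast
  have ne: "a \<noteq> t" "t \<noteq> b" using t Qa Qb by auto
  then have lt: "a < t" "t < b" using t by auto
  have C0: "C0 = - C1 * t - C2 * t\<^sup>2" using t by simp
  define e where "e = C1 + 2 * C2 * t"
  have sq: "C1\<^sup>2 - 4 * C0 * C2 = e\<^sup>2" by (simp add: C0 e_def algebra_simps power2_eq_square)
  have "0 < (a - t) * (C1 + C2 * (a + t))" using Qa by (simp add: C0 algebra_simps power2_eq_square)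
  then have A: "C1 + C2 * (a + t) < 0" using lt by (simp add: zero_less_mult_iff)
  have "(b - t) * (C1 + C2 * (b + t)) < 0" using Qb by (simp add: C0 algebra_simps power2_eq_square)
  then have B: "C1 + C2 * (b + t) < 0" using lt by (simp add: mult_less_0_iff)
  \<comment> \<open>\<open>A\<close> and \<open>B\<close> are negative secant slopes from
    \<open>t\<close> to the endpoints. The derivative \<open>e\<close> at \<open>t\<close> lies
    below one of them; the sign of \<open>C2\<close> decides which.\<close>
  have e: "e < 0"
  proof (cases "0 \<le> C2")
    case True
    then have "C2 * (2 * t) \<le> C2 * (b + t)" using lt by (intro mult_left_mono) auto
    with B show ?thesis by (simp add: e_def algebra_simps)
  next
    case False
    then have "C2 * (2 * t) \<le> C2 * (a + t)" using lt by (intro mult_left_mono_neg) auto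
    with A show ?thesis by (simp add: e_def algebra_simps)
  qed
  have "r = t"
  proof (cases "C2 = 0")
    case True
    then show ?thesis using e by (simp add: r_def C0 e_def)
  next
    case False
    have "sqrt (C1\<^sup>2 - 4 * C0 * C2) = - e" using e by (simp add: sq)
    then show ?thesis using False by (simp add: r_def e_def)
  qed
  then show "a < r" "r < b" "C0 + C1 * r + C2 * r\<^sup>2 = 0" using lt t by auto
qed

text \<open>\<open>lo\<close> and \<open>hi\<close> are the roots in s of (u - s)^2 - \<sigma> (1 -
  s^2). Its signs at -1, u and 1 locate them.\<close>

lemma wave_speeds_real:
  fixes u \<sigma> :: real
  assumes u: "u\<^sup>2 < 1" and \<sigma>: "0 < \<sigma>"
  defines "lo \<equiv> (u - sqrt (\<sigma> * (1 - u\<^sup>2 + \<sigma>))) / (1 + \<sigma>)"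
    and "hi \<equiv> (u + sqrt (\<sigma> * (1 - u\<^sup>2 + \<sigma>))) / (1 + \<sigma>)"
  shows "- 1 < lo" "lo < u" "u < hi" "hi < 1"
    and "\<And>s. s \<le> lo \<or> hi \<le> s \<Longrightarrow> \<sigma> * (1 - s\<^sup>2) \<le> (u - s)\<^sup>2"
proof -
  define q where "q = sqrt (\<sigma> * (1 - u\<^sup>2 + \<sigma>))"
  have q: "0 < q" "q\<^sup>2 = \<sigma> * (1 - u\<^sup>2 + \<sigma>)" using u \<sigma> by (auto simp: q_def)
  have lo: "(1 + \<sigma>) * lo = u - q" and hi: "(1 + \<sigma>) * hi = u + q"
    using \<sigma> by (auto simp: lo_def hi_def q_def)
  have fac: "(u - s)\<^sup>2 - \<sigma> * (1 - s\<^sup>2) = (1 + \<sigma>) * ((s - lo) * (s - hi))" for s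
  proof -
    have "(1 + \<sigma>) * ((1 + \<sigma>) * ((s - lo) * (s - hi)))
        = ((1 + \<sigma>) * s - (1 + \<sigma>) * lo) * ((1 + \<sigma>) * s - (1 + \<sigma>) * hi)"
      by (simp add: algebra_simps)
    also have "\<dots> = ((1 + \<sigma>) * s - u)\<^sup>2 - q\<^sup>2"
      unfolding lo hi by (simp add: algebra_simps power2_eq_square)
    also have "\<dots> = (1 + \<sigma>) * ((u - s)\<^sup>2 - \<sigma> * (1 - s\<^sup>2))"
      unfolding q by (simp add: algebra_simps power2_eq_square)
    finally show ?thesis using \<sigma> by simp
  qed
  have lohi: "lo < hi" using lo hi q(1) \<sigma> by (simp add: lo_def hi_def q_def divide_strict_right_mono)
  have au: "- 1 < u" "u < 1" using u by (auto simp: abs_square_less_1)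
  have "(u - lo) * (u - hi) < 0"
  proof -
    have "(1 + \<sigma>) * ((u - lo) * (u - hi)) < 0"
      unfolding fac[of u, symmetric] using u \<sigma> by simp
    then show ?thesis using \<sigma> by (simp add: mult_less_0_iff)
  qed
  then show 1: "lo < u" "u < hi" using lohi by (auto simp: mult_less_0_iff)
  have "0 < (- 1 - lo) * (- 1 - hi)"
  proof -
    have "0 < (1 + \<sigma>) * ((- 1 - lo) * (- 1 - hi))"
      unfolding fac[of "- 1", symmetric] using au by simp
    then show ?thesis using \<sigma> by (simp add: zero_less_mult_iff)
  qed
  then show "- 1 < lo" using au 1 by (auto simp: zero_less_mult_iff)
  have "0 < (1 - lo) * (1 - hi)"
  proof -
    have "0 < (1 + \<sigma>) * ((1 - lo) * (1 - hi))"
      unfolding fac[of 1, symmetric] using au by simp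
    then show ?thesis using \<sigma> by (simp add: zero_less_mult_iff)
  qed
  then show "hi < 1" using au 1 by (auto simp: zero_less_mult_iff)
  fix s assume "s \<le> lo \<or> hi \<le> s"
  then have "0 \<le> (s - lo) * (s - hi)" using lohi by (auto simp: zero_le_mult_iff)
  then have "0 \<le> (1 + \<sigma>) * ((s - lo) * (s - hi))" using \<sigma> by simp
  then show "\<sigma> * (1 - s\<^sup>2) \<le> (u - s)\<^sup>2" using fac[of s] by simp
qed

section \<open>Admissible states as an open convex cone\<close>

section \<open>The admissible cone\<close>

lemma mom_add: "mom (U + V) = mom U + mom V"
  and mom_diff: "mom (U - V) = mom U - mom V"
  and mom_scaleR: "mom (c *\<^sub>R U) = c *\<^sub>R mom U"
  by (simp_all add: mom_def vec_eq_iff forall_2)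

lemma vector_4 [simp]:
  "(vector [x, y, z, w] :: 'a::zero^4) $ 1 = x" "(vector [x, y, z, w] :: 'a^4) $ 2 = y"
  "(vector [x, y, z, w] :: 'a^4) $ 3 = z" "(vector [x, y, z, w] :: 'a^4) $ 4 = w"
  unfolding vector_def by simp_all

lemma enthalpy_eq:
  assumes "1 < \<Gamma>" "0 < \<rho>"
  shows "\<rho> * enthalpy \<Gamma> \<rho> p = \<rho> + \<Gamma> / (\<Gamma> - 1) * p"
  using assms by (simp add: enthalpy_def field_simps)

lemma admissible_primitive:
  assumes "U \<in> admissible \<Gamma>"
  shows "0 < density \<Gamma> U" "0 < pressure \<Gamma> U" "norm (velocity \<Gamma> U) < 1"
    and "conserved \<Gamma> (density \<Gamma> U, velocity \<Gamma> U, pressure \<Gamma> U) = U"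
proof -
  have "primitive \<Gamma> U \<in> prim_domain" "conserved \<Gamma> (primitive \<Gamma> U) = U"
    using assms by (auto simp: admissible_def primitive_def inv_into_into f_inv_into_f)
  then show "0 < density \<Gamma> U" "0 < pressure \<Gamma> U" "norm (velocity \<Gamma> U) < 1"
    "conserved \<Gamma> (density \<Gamma> U, velocity \<Gamma> U, pressure \<Gamma> U) = U"
    by (auto simp: prim_domain_def density_def pressure_def velocity_def)
qed

text \<open>\<open>g\<close> is the reciprocal of the specific enthalpy and \<open>w\<close> is $\rho h \gamma^2 = E + p$.\<close>

lemma admissible_coords:
  assumes \<Gamma>: "1 < \<Gamma>" "\<Gamma> \<le> 2" and U: "U \<in> admissible \<Gamma>"
  obtains g w W where "0 < g" "g < 1" "0 < w" "0 < W" "W = 1 - (norm (velocity \<Gamma> U))\<^sup>2"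
    "pressure \<Gamma> U = (\<Gamma> - 1) / \<Gamma> * (1 - g) * W * w"
    "0 < U $ 1" "(U $ 1)\<^sup>2 = w\<^sup>2 * W * g\<^sup>2" "mom U = w *\<^sub>R velocity \<Gamma> U"
    "U $ 4 = w - pressure \<Gamma> U"
    "sigma_s \<Gamma> U = (\<Gamma> - 1) * (1 - g) * W / (1 - (\<Gamma> - 1) * (1 - g))"
proof -
  define \<rho> where "\<rho> = density \<Gamma> U"
  define u where "u = velocity \<Gamma> U"
  define p where "p = pressure \<Gamma> U"
  define h where "h = enthalpy \<Gamma> \<rho> p"
  define W where "W = 1 - (norm u)\<^sup>2"
  define w where "w = \<rho> * h / W"
  have prim: "0 < \<rho>" "0 < p" "norm u < 1" "conserved \<Gamma> (\<rho>, u, p) = U"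
    using admissible_primitive[OF U] by (simp_all add: \<rho>_def u_def p_def)
  have W: "0 < W" using prim(3) by (simp add: W_def power_less_one_iff abs_square_less_1)
  have \<gamma>: "lorentz u = 1 / sqrt W" by (simp add: lorentz_def W_def)
  have \<rho>h: "\<rho> * h = \<rho> + \<Gamma> / (\<Gamma> - 1) * p" unfolding h_def using enthalpy_eq \<Gamma> prim by simp
  then have "\<rho> * 1 < \<rho> * h" using \<Gamma> prim by simp
  then have h: "1 < h" using prim by simp
  have ww: "\<rho> * lorentz u * h * lorentz u = w"
    using W by (simp add: \<gamma> w_def)
  have comps: "U $ 1 = \<rho> / sqrt W" "U $ 2 = w * u $ 1" "U $ 3 = w * u $ 2" "U $ 4 = w - p"
  proof -
    have "U = vector [\<rho> * lorentz u, w * u $ 1, w * u $ 2, w - p]"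
      unfolding prim(4)[symmetric] by (simp only: conserved_def prod.case Let_def h_def[symmetric] ww)
    then show "U $ 1 = \<rho> / sqrt W" "U $ 2 = w * u $ 1" "U $ 3 = w * u $ 2" "U $ 4 = w - p"
      by (simp_all add: \<gamma>)
  qed
  have p: "p = (\<Gamma> - 1) / \<Gamma> * (\<rho> * h - \<rho>)" using \<rho>h \<Gamma> by simp
  have p': "p = (\<Gamma> - 1) / \<Gamma> * (1 - 1 / h) * W * w" unfolding p w_def using W h \<Gamma> by (simp add: field_simps)
  have cs: "(sound_speed \<Gamma> U)\<^sup>2 = (\<Gamma> - 1) * (1 - 1 / h)"
  proof -
    have "0 \<le> \<Gamma> * p / (\<rho> * h)" using \<Gamma> prim h by simp
    then have "(sound_speed \<Gamma> U)\<^sup>2 = \<Gamma> * p / (\<rho> * h)"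
      by (simp add: sound_speed_def Let_def flip: \<rho>_def p_def h_def)
    also have "\<dots> = (\<Gamma> - 1) * (1 - 1 / h)" unfolding p using \<Gamma> prim h by (simp add: field_simps)
    finally show ?thesis .
  qed
  show ?thesis
  proof (rule that[of "1 / h" w W])
    show "(U $ 1)\<^sup>2 = w\<^sup>2 * W * (1 / h)\<^sup>2"
      using W h by (simp add: comps w_def power_divide power_mult_distrib) (simp add: power2_eq_square)
    show "mom U = w *\<^sub>R velocity \<Gamma> U"
      by (simp add: mom_def comps vec_eq_iff forall_2 flip: u_def)
    show "sigma_s \<Gamma> U = (\<Gamma> - 1) * (1 - 1 / h) * W / (1 - (\<Gamma> - 1) * (1 - 1 / h))"
      using W unfolding sigma_s_def cs u_def[symmetric] \<gamma> by (simp add: power_divide)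
    show "pressure \<Gamma> U = (\<Gamma> - 1) / \<Gamma> * (1 - 1 / h) * W * w" using p' by (simp add: p_def)
  qed (use h W prim comps in \<open>auto simp: w_def W_def u_def p_def\<close>)
qed

text \<open>The equation says that rho h gamma^2 equals E + p when the speed is M / (E + p). Its
  residual is negative at p = 0 by the cone inequality and positive at p = E because
  \<open>\<Gamma> / (\<Gamma> - 1)\<close> is at least 2.\<close>

lemma pressure_exists:
  fixes D E M \<Gamma> :: real
  assumes \<Gamma>: "1 < \<Gamma>" "\<Gamma> \<le> 2" and D: "0 < D" and E: "0 < E" "D\<^sup>2 + M\<^sup>2 < E\<^sup>2"
  obtains p where "0 < p" "D / sqrt (1 - (M / (E + p))\<^sup>2) + \<Gamma> / (\<Gamma> - 1) * p / (1 - (M / (E + p))\<^sup>2) = E + p"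
proof -
  define V where "V = (\<lambda>p. 1 - (M / (E + p))\<^sup>2)"
  define f where "f = (\<lambda>p. D / sqrt (V p) + \<Gamma> / (\<Gamma> - 1) * p / V p - (E + p))"
  have "M\<^sup>2 < E\<^sup>2" using E zero_less_power[OF D, of 2] by linarith
  have V: "0 < V p" "V p \<le> 1" if "0 \<le> p" for p
  proof -
    have "E\<^sup>2 \<le> (E + p)\<^sup>2" using that E by (intro power_mono) auto
    with \<open>M\<^sup>2 < E\<^sup>2\<close> have "M\<^sup>2 < (E + p)\<^sup>2" by linarith
    then show "0 < V p" using that E by (simp add: V_def power_divide)
    show "V p \<le> 1" by (simp add: V_def)
  qed
  have kappa: "2 \<le> \<Gamma> / (\<Gamma> - 1)" using \<Gamma> by (simp add: field_simps)
  have "V 0 * E\<^sup>2 = E\<^sup>2 - M\<^sup>2" using E by (simp add: V_def power_divide field_simps)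
  then have "D\<^sup>2 < (E * sqrt (V 0))\<^sup>2" using E V[of 0] by (simp add: power_mult_distrib mult.commute)
  then have "D < E * sqrt (V 0)" by (rule power2_less_imp_less) (use E V[of 0] in simp)
  then have f0: "f 0 < 0" using V[of 0] by (simp add: f_def field_simps)
  have fE: "0 < f E"
  proof -
    have VE: "0 < V E" "V E \<le> 1" using V E by auto
    then have "D \<le> D / sqrt (V E)" using D by (simp add: field_simps)
    moreover have "2 * E \<le> \<Gamma> / (\<Gamma> - 1) * E / V E"
    proof -
      have "2 * E \<le> \<Gamma> / (\<Gamma> - 1) * E / 1" using mult_right_mono[OF kappa, of E] E by simp
      also have "\<dots> \<le> \<Gamma> / (\<Gamma> - 1) * E / V E" using VE \<Gamma> E by (intro divide_left_mono) auto
      finally show ?thesis .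
    qed
    ultimately show ?thesis using D by (simp add: f_def)
  qed
  have "continuous_on {0..E} V" unfolding V_def using E by (intro continuous_intros) auto
  moreover have "V p \<noteq> 0" if "p \<in> {0..E}" for p using V(1)[of p] that by auto
  ultimately have "continuous_on {0..E} f" unfolding f_def
    by (intro continuous_intros) auto
  then have "\<exists>p. 0 \<le> p \<and> p \<le> E \<and> f p = 0"
    using f0 fE E by (intro IVT') auto
  then obtain p where p: "0 \<le> p" "f p = 0" by blast
  with f0 have "0 < p" by (cases "p = 0") auto
  then show ?thesis using p(2) by (intro that[of p]) (auto simp: f_def V_def)
qed

lemma norm_Pair_less_iff:
  assumes "0 < e"
  shows "norm (d :: real, m :: real^2) < e \<longleftrightarrow> d\<^sup>2 + (norm m)\<^sup>2 < e\<^sup>2"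
  using assms real_sqrt_less_iff[of "d\<^sup>2 + (norm m)\<^sup>2" "e\<^sup>2"] by (simp add: norm_prod_def)

text \<open>Writing the cone with the norm of a pair makes closure under addition the triangle
  inequality. Forwards, E^2 - D^2 - |m|^2 is an explicit positive expression in \<open>g\<close>,
  \<open>w\<close>, \<open>W\<close>; backwards, the primitive variables are rebuilt from the root
  of \<open>pressure_exists\<close>.\<close>

lemma admissible_iff:
  assumes \<Gamma>: "1 < \<Gamma>" "\<Gamma> \<le> 2"
  shows "U \<in> admissible \<Gamma> \<longleftrightarrow> 0 < U $ 1 \<and> norm (U $ 1, mom U) < U $ 4"
proof
  assume "U \<in> admissible \<Gamma>"
  then obtain g w W where *: "0 < g" "g < 1" "0 < w" "0 < W" "W = 1 - (norm (velocity \<Gamma> U))\<^sup>2"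
    "pressure \<Gamma> U = (\<Gamma> - 1) / \<Gamma> * (1 - g) * W * w"
    "0 < U $ 1" "(U $ 1)\<^sup>2 = w\<^sup>2 * W * g\<^sup>2" "mom U = w *\<^sub>R velocity \<Gamma> U"
    "U $ 4 = w - pressure \<Gamma> U"
    by (rule admissible_coords[OF \<Gamma>])
  define r where "r = (\<Gamma> - 1) / \<Gamma>"
  have r: "0 < r" "r \<le> 1 / 2" using \<Gamma> by (auto simp: r_def field_simps)
  have W1: "W \<le> 1" unfolding *(5) by simp
  have p: "pressure \<Gamma> U = r * (1 - g) * W * w" unfolding r_def by (rule *(6))
  have "r * (1 - g) * W \<le> 1 / 2 * 1 * 1" using *(1,2,4) r W1 by (intro mult_mono) auto
  then have "r * (1 - g) * W < 1" by simp
  then have "r * (1 - g) * W * w < 1 * w" using *(3) by (rule mult_strict_right_mono)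
  then have E0: "0 < U $ 4" unfolding *(10) p by linarith
  have v2: "(norm (velocity \<Gamma> U))\<^sup>2 = 1 - W" unfolding *(5) by simp
  \<comment> \<open>\<open>\<Gamma> \<le> 2\<close> gives \<open>r \<le> 1 / 2\<close>, which keeps
    the pressure term below the gain \<open>(1 - g) * (1 + g)\<close>.\<close>
  have "2 * r * (1 - g) \<le> 1 * (1 - g)" using r *(2) by (intro mult_right_mono) auto
  moreover have "0 < (1 - g) * g" using *(1,2) by simp
  ultimately have "0 < (1 - g) * (1 + g) - 2 * r * (1 - g)" by (simp add: algebra_simps)
  then have "0 < w\<^sup>2 * W * ((1 - g) * (1 + g) - 2 * r * (1 - g)) + (r * (1 - g) * W * w)\<^sup>2"
    using *(3,4) by (intro add_pos_nonneg mult_pos_pos) auto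
  also have "\<dots> = (U $ 4)\<^sup>2 - ((U $ 1)\<^sup>2 + w\<^sup>2 * (1 - W))"
    unfolding *(8,10) p by (simp add: algebra_simps power2_eq_square)
  also have "w\<^sup>2 * (1 - W) = (norm (mom U))\<^sup>2" unfolding v2[symmetric] *(9) by (simp add: power_mult_distrib)
  finally have "(U $ 1)\<^sup>2 + (norm (mom U))\<^sup>2 < (U $ 4)\<^sup>2" by linarith
  then show "0 < U $ 1 \<and> norm (U $ 1, mom U) < U $ 4"
    using *(7) norm_Pair_less_iff[OF E0] by blast
next
  assume asm: "0 < U $ 1 \<and> norm (U $ 1, mom U) < U $ 4"
  define D E where "D = U $ 1" and "E = U $ 4"
  have D: "0 < D" and E0: "0 < E"
    using asm norm_ge_zero[of "(U $ 1, mom U)"] by (auto simp: D_def E_def simp del: norm_ge_zero)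
  have EE: "D\<^sup>2 + (norm (mom U))\<^sup>2 < E\<^sup>2"
    using asm E0 norm_Pair_less_iff by (simp add: D_def E_def)
  obtain p where p: "0 < p"
    "D / sqrt (1 - (norm (mom U) / (E + p))\<^sup>2) + \<Gamma> / (\<Gamma> - 1) * p / (1 - (norm (mom U) / (E + p))\<^sup>2) = E + p"
    by (rule pressure_exists[OF \<Gamma> D E0 EE])
  \<comment> \<open>The velocity comes from m = (E + p) u, the density from D = rho gamma.\<close>
  define u where "u = (1 / (E + p)) *\<^sub>R mom U"
  define W where "W = 1 - (norm u)\<^sup>2"
  define \<rho> where "\<rho> = D * sqrt W"
  have nu: "norm u = norm (mom U) / (E + p)" using E0 p(1) by (simp add: u_def)
  have "(norm (mom U))\<^sup>2 < E\<^sup>2" using EE zero_less_power[OF D, of 2] by linarith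
  then have "norm (mom U) < E" using E0 by (simp add: power2_less_imp_less)
  then have u1: "norm u < 1" using E0 p(1) nu by simp
  then have W: "0 < W" by (simp add: W_def power_less_one_iff abs_square_less_1)
  have eq: "D / sqrt W + \<Gamma> / (\<Gamma> - 1) * p / W = E + p" using p(2) by (simp add: W_def nu)
  have \<rho>: "0 < \<rho>" using D W by (simp add: \<rho>_def)
  have \<gamma>: "lorentz u = 1 / sqrt W" by (simp add: lorentz_def W_def)
  have D': "\<rho> * lorentz u = D" using W by (simp add: \<rho>_def \<gamma>)
  have "D * enthalpy \<Gamma> \<rho> p * lorentz u = (\<rho> * enthalpy \<Gamma> \<rho> p) / W"
    unfolding D'[symmetric] using W by (simp add: \<gamma>)
  also have "\<dots> = D / sqrt W + \<Gamma> / (\<Gamma> - 1) * p / W"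
  proof -
    have "\<rho> / (sqrt W * sqrt W) = D / sqrt W"
      unfolding \<rho>_def by (rule nonzero_mult_divide_mult_cancel_right) (use W in simp)
    then have "\<rho> / W = D / sqrt W" using W by simp
    then show ?thesis unfolding enthalpy_eq[OF \<Gamma>(1) \<rho>] add_divide_distrib by simp
  qed
  finally have w: "D * enthalpy \<Gamma> \<rho> p * lorentz u = E + p" using eq by simp
  have "conserved \<Gamma> (\<rho>, u, p) = vector [D, (E + p) * u $ 1, (E + p) * u $ 2, E + p - p]"
    by (simp only: conserved_def prod.case Let_def D' w)
  also have "\<dots> = U"
    using E0 p(1) by (simp add: vec_eq_iff forall_4 u_def mom_def D_def E_def)
  finally have "conserved \<Gamma> (\<rho>, u, p) = U" .
  moreover have "(\<rho>, u, p) \<in> prim_domain" using \<rho> p(1) u1 by (simp add: prim_domain_def)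
  ultimately show "U \<in> admissible \<Gamma>" unfolding admissible_def by blast
qed

lemma admissible_add:
  assumes "1 < \<Gamma>" "\<Gamma> \<le> 2" "U \<in> admissible \<Gamma>" "V \<in> admissible \<Gamma>"
  shows "U + V \<in> admissible \<Gamma>"
  using assms norm_triangle_ineq[of "(U $ 1, mom U)" "(V $ 1, mom V)"]
  by (simp add: admissible_iff mom_add)

lemma admissible_scaleR:
  assumes "1 < \<Gamma>" "\<Gamma> \<le> 2" "U \<in> admissible \<Gamma>" "0 < c"
  shows "c *\<^sub>R U \<in> admissible \<Gamma>"
proof -
  have "norm (c * U $ 1, c *\<^sub>R mom U) = c * norm (U $ 1, mom U)"
    using assms(4) norm_scaleR[of c "(U $ 1, mom U)"] by (simp del: norm_scaleR)
  then show ?thesis using assms by (simp add: admissible_iff mom_scaleR)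
qed

lemma admissible_sum:
  assumes "1 < \<Gamma>" "\<Gamma> \<le> 2" "finite A" "A \<noteq> {}" "\<And>a. a \<in> A \<Longrightarrow> f a \<in> admissible \<Gamma>"
  shows "sum f A \<in> admissible \<Gamma>"
  using assms(3-5) by (induction rule: finite_ne_induct) (auto intro: admissible_add[OF assms(1,2)])

section \<open>Normal waves of a single admissible state\<close>

section \<open>Wave speeds and the state behind the left wave\<close>

text \<open>The normal flux of a state is u_n U plus this vector at the pressure and normal velocity
  of the state; the HLLC flux is this vector at the contact pressure and contact speed.\<close>

definition pressure_flux :: "real^2 \<Rightarrow> real \<Rightarrow> real \<Rightarrow> state" where
  "pressure_flux n p s = vector [0, p * n $ 1, p * n $ 2, p * s]"

lemma pressure_flux_sel [simp]:
  "pressure_flux n p s $ 1 = 0" "pressure_flux n p s $ 4 = p * s" "mom (pressure_flux n p s) = p *\<^sub>R n"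
  by (simp_all add: pressure_flux_def mom_def vec_eq_iff forall_2)

lemma pressure_flux_minus: "pressure_flux (- n) p (- s) = - pressure_flux n p s"
  by (simp add: pressure_flux_def vec_eq_iff forall_4)

lemma s_min_minus: "s_min \<Gamma> (- n) U = - s_max \<Gamma> n U"
  unfolding s_min_def s_max_def Let_def minus_divide_left by simp

lemma mom_eq:
  assumes "1 < \<Gamma>" "\<Gamma> \<le> 2" "U \<in> admissible \<Gamma>"
  shows "mom U = (U $ 4 + pressure \<Gamma> U) *\<^sub>R velocity \<Gamma> U"
  by (rule admissible_coords[OF assms]) simp

lemma velocity_bound:
  assumes "U \<in> admissible \<Gamma>" "norm n = 1"
  shows "(velocity \<Gamma> U \<bullet> n)\<^sup>2 \<le> (norm (velocity \<Gamma> U))\<^sup>2" "\<bar>velocity \<Gamma> U \<bullet> n\<bar> < 1"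
proof -
  have "\<bar>velocity \<Gamma> U \<bullet> n\<bar> \<le> norm (velocity \<Gamma> U)"
    using Cauchy_Schwarz_ineq2[of "velocity \<Gamma> U" n] assms by simp
  then show "(velocity \<Gamma> U \<bullet> n)\<^sup>2 \<le> (norm (velocity \<Gamma> U))\<^sup>2" "\<bar>velocity \<Gamma> U \<bullet> n\<bar> < 1"
    using admissible_primitive(3)[OF assms(1)] abs_le_square_iff[of "velocity \<Gamma> U \<bullet> n" "norm (velocity \<Gamma> U)"]
    by auto
qed

lemma wave_speeds:
  assumes \<Gamma>: "1 < \<Gamma>" "\<Gamma> \<le> 2" and U: "U \<in> admissible \<Gamma>" and n: "norm n = 1"
  shows "- 1 < s_min \<Gamma> n U" "s_min \<Gamma> n U < velocity \<Gamma> U \<bullet> n"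
    "velocity \<Gamma> U \<bullet> n < s_max \<Gamma> n U" "s_max \<Gamma> n U < 1"
    and "\<And>s. s \<le> s_min \<Gamma> n U \<or> s_max \<Gamma> n U \<le> s \<Longrightarrow>
      sigma_s \<Gamma> U * (1 - s\<^sup>2) \<le> (velocity \<Gamma> U \<bullet> n - s)\<^sup>2"
proof -
  obtain g w W where *: "0 < g" "g < 1" "0 < W"
    "sigma_s \<Gamma> U = (\<Gamma> - 1) * (1 - g) * W / (1 - (\<Gamma> - 1) * (1 - g))"
    by (rule admissible_coords[OF \<Gamma> U])
  \<comment> \<open>The squared sound speed lies strictly between 0 and 1, so \<open>sigma_s\<close>
    is positive and \<open>wave_speeds_real\<close> applies.\<close>
  have "(\<Gamma> - 1) * (1 - g) \<le> 1 * (1 - g)" using \<Gamma> *(2) by (intro mult_right_mono) auto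
  then have "(\<Gamma> - 1) * (1 - g) < 1" by (rule le_less_trans) (use *(1) in simp)
  then have "0 < sigma_s \<Gamma> U" unfolding *(4) using *(1-3) \<Gamma> by (intro divide_pos_pos mult_pos_pos) auto
  moreover have "(velocity \<Gamma> U \<bullet> n)\<^sup>2 < 1" using velocity_bound[OF U n] by (simp add: abs_square_less_1)
  ultimately show "- 1 < s_min \<Gamma> n U" "s_min \<Gamma> n U < velocity \<Gamma> U \<bullet> n"
    "velocity \<Gamma> U \<bullet> n < s_max \<Gamma> n U" "s_max \<Gamma> n U < 1"
    "\<And>s. s \<le> s_min \<Gamma> n U \<or> s_max \<Gamma> n U \<le> s \<Longrightarrow>
      sigma_s \<Gamma> U * (1 - s\<^sup>2) \<le> (velocity \<Gamma> U \<bullet> n - s)\<^sup>2"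
    unfolding s_min_def s_max_def Let_def using wave_speeds_real by blast+
qed

text \<open>The left-hand side is \<open>s - sL\<close> times the state behind the left wave; \<open>P\<close> and \<open>s\<close> are its
  pressure and normal velocity, and \<open>P\<close> may be negative.\<close>

lemma star_state_admissible:
  assumes \<Gamma>: "1 < \<Gamma>" "\<Gamma> \<le> 2" and U: "U \<in> admissible \<Gamma>" and n: "norm n = 1"
    and sL: "- 1 < sL" "sL \<le> s_min \<Gamma> n U" and s: "\<bar>s\<bar> < 1"
    and P: "P * (1 - sL * s) = s * hllc_A n sL U - hllc_B \<Gamma> n sL U"
  shows "(velocity \<Gamma> U \<bullet> n - sL) *\<^sub>R U + pressure_flux n (pressure \<Gamma> U) (velocity \<Gamma> U \<bullet> n)
    - pressure_flux n P s \<in> admissible \<Gamma>"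
proof -
  define v where "v = velocity \<Gamma> U"
  define u where "u = v \<bullet> n"
  define p where "p = pressure \<Gamma> U"
  obtain g w W where *: "0 < g" "g < 1" "0 < w" "0 < W" "W = 1 - (norm v)\<^sup>2"
    "p = (\<Gamma> - 1) / \<Gamma> * (1 - g) * W * w"
    "0 < U $ 1" "(U $ 1)\<^sup>2 = w\<^sup>2 * W * g\<^sup>2" "mom U = w *\<^sub>R v"
    "U $ 4 = w - p"
    "sigma_s \<Gamma> U = (\<Gamma> - 1) * (1 - g) * W / (1 - (\<Gamma> - 1) * (1 - g))"
    unfolding v_def p_def by (rule admissible_coords[OF \<Gamma> U])
  define c2 where "c2 = (\<Gamma> - 1) * (1 - g)"
  define a where "a = u - sL"
  define k where "k = w * a"
  have "c2 \<le> 1 * (1 - g)" unfolding c2_def using \<Gamma> *(2) by (intro mult_right_mono) auto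
  then have c2: "c2 < 1" using *(1) by simp
  have u: "u\<^sup>2 \<le> (norm v)\<^sup>2" "\<bar>u\<bar> < 1" using velocity_bound[OF U n] by (simp_all add: u_def v_def)
  have "sL < u" using sL wave_speeds(2)[OF \<Gamma> U n] by (simp add: u_def v_def)
  have "sigma_s \<Gamma> U * (1 - sL\<^sup>2) \<le> (u - sL)\<^sup>2"
    using wave_speeds(5)[OF \<Gamma> U n] sL by (simp add: u_def v_def)
  then have char: "c2 * W * (1 - sL\<^sup>2) \<le> (1 - c2) * (u - sL)\<^sup>2"
    unfolding *(11) c2_def[symmetric] using c2 by (simp add: pos_divide_le_eq mult.commute)
  have nn: "n \<bullet> n = 1" using n by (simp add: dot_square_norm)
  have un: "mom U \<bullet> n = w * u" by (simp add: *(9) u_def)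
  \<comment> \<open>With E = w - p and m_n = w u, the relation defining \<open>P\<close> becomes one
    for the pressure jump.\<close>
  have P': "(P - p) * (1 - sL * s) = k * (u - s)"
    using P unfolding hllc_A_def hllc_B_def un *(10)
    by (simp add: k_def a_def u_def v_def p_def algebra_simps)
  define V where "V = a *\<^sub>R U + pressure_flux n p u - pressure_flux n P s"
  have W1: "W \<le> 1 - u\<^sup>2" using *(5) u by simp
  have V4: "V $ 4 = (u - sL) * (w - p) - (P * s - p * u)" by (simp add: V_def *(10) a_def)
  have real: "0 < V $ 4"
    "(k * u - (P - p))\<^sup>2 + k\<^sup>2 * (1 - W - u\<^sup>2) + k\<^sup>2 * W * g\<^sup>2 < (V $ 4)\<^sup>2"
    using star_state_real[OF \<Gamma> *(1,2,4) W1 *(3,6) c2_def sL(1) \<open>sL < u\<close> _ s char _ P' V4] u(2)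
    by (simp_all add: k_def a_def)
  have V1: "V $ 1 = a * U $ 1" by (simp add: V_def)
  have "mom V = k *\<^sub>R v - (P - p) *\<^sub>R n"
    by (simp add: V_def mom_add mom_diff mom_scaleR *(9) k_def scaleR_left_diff_distrib mult.commute)
  then have "(norm (mom V))\<^sup>2 = k\<^sup>2 * (norm v)\<^sup>2 - 2 * k * (P - p) * u + (P - p)\<^sup>2"
    unfolding power2_norm_eq_inner
    by (simp add: inner_diff_left inner_diff_right nn u_def inner_commute[of n v] power2_eq_square)
       (simp add: algebra_simps)
  also have "(norm v)\<^sup>2 = 1 - W" using *(5) by simp
  finally have "(V $ 1)\<^sup>2 + (norm (mom V))\<^sup>2 < (V $ 4)\<^sup>2"
    using real(2) by (simp add: V1 power_mult_distrib *(8) k_def) (simp add: algebra_simps power2_eq_square)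
  moreover have "0 < V $ 1" using \<open>sL < u\<close> *(7) by (simp add: V1 a_def)
  ultimately have "V \<in> admissible \<Gamma>"
    using real(1) by (simp add: admissible_iff[OF \<Gamma>] norm_Pair_less_iff)
  then show ?thesis by (simp add: V_def a_def u_def v_def p_def)
qed

text \<open>At the far end \<open>s\<close> of the wave fan of a state, the pressure that a jump across the wave with
  speed \<open>s'\<close> would produce is negative.\<close>

lemma wave_fan:
  assumes \<Gamma>: "1 < \<Gamma>" "\<Gamma> \<le> 2" and U: "U \<in> admissible \<Gamma>" and n: "norm n = 1"
    and s: "s \<le> s_min \<Gamma> n U \<and> s_max \<Gamma> n U \<le> s' \<or> s' \<le> s_min \<Gamma> n U \<and> s_max \<Gamma> n U \<le> s"
  shows "s * hllc_A n s' U - hllc_B \<Gamma> n s' U < 0"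
proof -
  define v where "v = velocity \<Gamma> U"
  define u where "u = v \<bullet> n"
  define p where "p = pressure \<Gamma> U"
  obtain g w W where *: "0 < g" "g < 1" "0 < w" "0 < W" "W = 1 - (norm v)\<^sup>2"
    "p = (\<Gamma> - 1) / \<Gamma> * (1 - g) * W * w" "mom U = w *\<^sub>R v" "U $ 4 = w - p"
    "sigma_s \<Gamma> U = (\<Gamma> - 1) * (1 - g) * W / (1 - (\<Gamma> - 1) * (1 - g))"
    unfolding v_def p_def by (rule admissible_coords[OF \<Gamma> U])
  define c2 where "c2 = (\<Gamma> - 1) * (1 - g)"
  \<comment> \<open>The two cases of \<open>s\<close> are mirror images. Only \<open>s * s'\<close>
    and \<open>(s - u) * (s' - u)\<close> enter, both symmetric, so ordering the two speeds by
    \<open>min\<close> and \<open>max\<close> treats the cases together.\<close>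
  define a where "a = u - min s s'"
  define r where "r = max s s' - u"
  have "c2 \<le> 1 * (1 - g)" unfolding c2_def using \<Gamma> *(2) by (intro mult_right_mono) auto
  then have c2: "c2 < 1" using *(1) by simp
  have c2': "0 < c2" "c2 < \<Gamma> - 1" using \<Gamma> *(1,2) by (auto simp: c2_def)
  have u: "u\<^sup>2 \<le> (norm v)\<^sup>2" using velocity_bound[OF U n] by (simp add: u_def v_def)
  have lt: "s_min \<Gamma> n U < u" "u < s_max \<Gamma> n U" using wave_speeds[OF \<Gamma> U n] by (simp_all add: u_def v_def)
  have char: "c2 * W * (1 - t\<^sup>2) \<le> (1 - c2) * (u - t)\<^sup>2" if "t = s \<or> t = s'" for t
  proof -
    have "sigma_s \<Gamma> U * (1 - t\<^sup>2) \<le> (u - t)\<^sup>2"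
      unfolding u_def v_def by (rule wave_speeds(5)[OF \<Gamma> U n]) (use s that in auto)
    then show ?thesis
      unfolding *(9) c2_def[symmetric] using c2 by (simp add: pos_divide_le_eq mult.commute)
  qed
  have "c2 / \<Gamma> * W * (1 - (u - a) * (u + r)) < r * a"
  proof (rule wave_fan_real[OF \<Gamma>(1) c2' c2 *(4)])
    show "W \<le> 1 - u\<^sup>2" using *(5) u by simp
    show "0 < a" "0 < r" using s lt by (auto simp: a_def r_def)
    show "c2 * W * (1 - (u - a)\<^sup>2) \<le> (1 - c2) * a\<^sup>2"
      using char[of "min s s'"] by (simp add: a_def min_def)
    show "c2 * W * (1 - (u + r)\<^sup>2) \<le> (1 - c2) * r\<^sup>2"
      using char[of "max s s'"] by (simp add: r_def max_def power2_commute)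
  qed
  also have "(u - a) * (u + r) = s * s'" by (simp add: a_def r_def min_def max_def)
  also have "r * a = - (s - u) * (s' - u)"
    using s lt by (auto simp: a_def r_def min_def max_def algebra_simps)
  \<comment> \<open>The quantity to be shown negative equals
    \<open>w * (s - u) * (s' - u) + p * (1 - s * s')\<close>; its first term is negative because
    \<open>u\<close> separates the speeds.\<close>
  finally have "w * (c2 / \<Gamma> * W * (1 - s * s')) < w * (- (s - u) * (s' - u))"
    using *(3) by (rule mult_strict_left_mono)
  moreover have "w * (c2 / \<Gamma> * W * (1 - s * s')) = p * (1 - s * s')" by (simp add: *(6) c2_def)
  ultimately show ?thesis
    by (simp add: hllc_A_def hllc_B_def *(7,8) flip: v_def u_def p_def) (simp add: algebra_simps)
qed

text \<open>The case $P = 0$ of the star state of the reflected problem.\<close>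

lemma flux_splitting:
  assumes \<Gamma>: "1 < \<Gamma>" "\<Gamma> \<le> 2" and U: "U \<in> admissible \<Gamma>" and n: "norm n = 1"
    and \<alpha>: "s_max \<Gamma> n U \<le> \<alpha>"
  shows "(\<alpha> - velocity \<Gamma> U \<bullet> n) *\<^sub>R U - pressure_flux n (pressure \<Gamma> U) (velocity \<Gamma> U \<bullet> n) \<in> admissible \<Gamma>"
proof -
  define u where "u = velocity \<Gamma> U \<bullet> n"
  \<comment> \<open>Reflecting the normal turns \<open>u\<close> into \<open>- u\<close> and the
    right wave into a left one: \<open>sL\<close> is \<open>- s_max \<Gamma> n U\<close>.\<close>
  define sL where "sL = s_min \<Gamma> (- n) U"
  define b where "b = s_max \<Gamma> (- n) U"
  define A where "A = hllc_A (- n) sL U"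
  define B where "B = hllc_B \<Gamma> (- n) sL U"
  have n': "norm (- n) = 1" using n by simp
  note ws = wave_speeds[OF \<Gamma> U n', folded sL_def b_def, simplified, folded u_def]
  have b: "b * A - B < 0"
    unfolding A_def B_def by (rule wave_fan[OF \<Gamma> U n']) (simp add: sL_def b_def)
  have "0 < pressure \<Gamma> U" by (rule admissible_primitive(2)[OF U])
  moreover have "sL * - u < 1" using ws by (intro mult_less_one_abs) auto
  ultimately have "0 < pressure \<Gamma> U * (1 - sL * - u)" by simp
  also have "\<dots> = - u * A - B"
    by (simp add: A_def B_def hllc_A_def hllc_B_def u_def mom_eq[OF \<Gamma> U] algebra_simps)
  finally have a: "0 < - u * A - B" .
  \<comment> \<open>At \<open>- u\<close> the jump is trivial and the pressure is that of
    \<open>U\<close>, hence positive; at \<open>b\<close> it is negative by \<open>wave_fan\<close>.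
    In between lies a speed at which the star pressure vanishes.\<close>
  have "\<exists>s. - u \<le> s \<and> s \<le> b \<and> s * A - B = 0"
    using a b ws by (intro IVT2') (auto intro!: continuous_intros)
  then obtain s where s: "- u \<le> s" "s \<le> b" "s * A - B = 0" by blast
  have "\<bar>s\<bar> < 1" using s ws by auto
  from star_state_admissible[OF \<Gamma> U n' _ _ this, of sL 0]
  have "(- u - sL) *\<^sub>R U + pressure_flux (- n) (pressure \<Gamma> U) (- u) - pressure_flux (- n) 0 s \<in> admissible \<Gamma>"
    using s(3) ws by (simp add: A_def B_def sL_def u_def)
  also have "pressure_flux (- n) 0 s = 0" by (simp add: pressure_flux_def vec_eq_iff forall_4)
  finally have *: "(s_max \<Gamma> n U - u) *\<^sub>R U - pressure_flux n (pressure \<Gamma> U) u \<in> admissible \<Gamma>"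
    by (simp add: pressure_flux_minus sL_def s_min_minus)
  \<comment> \<open>A larger \<open>\<alpha>\<close> adds a multiple of \<open>U\<close>; the cone
    omits 0, so the zero multiple is a separate case.\<close>
  show ?thesis
  proof (cases "\<alpha> = s_max \<Gamma> n U")
    case True
    then show ?thesis using * by (simp add: u_def)
  next
    case False
    then have "(\<alpha> - s_max \<Gamma> n U) *\<^sub>R U \<in> admissible \<Gamma>"
      using \<alpha> by (intro admissible_scaleR[OF \<Gamma> U]) auto
    from admissible_add[OF \<Gamma> this *] show ?thesis
      by (simp add: u_def algebra_simps)
  qed
qed

section \<open>The contact speed and the update at one Simpson point\<close>

section \<open>The HLLC flux\<close>

text \<open>The quadratic compares the two one-sided pressures after multiplication by both
  denominators. At each outer speed the numerator of the state on that side is positive and that of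
  the opposite state is negative by \<open>wave_fan\<close>, so the quadratic changes sign between
  \<open>sL\<close> and \<open>sR\<close>.\<close>

lemma contact_wave:
  assumes \<Gamma>: "1 < \<Gamma>" "\<Gamma> \<le> 2" and UL: "UL \<in> admissible \<Gamma>" and UR: "UR \<in> admissible \<Gamma>" and n: "norm n = 1"
  defines "sL \<equiv> min (s_min \<Gamma> n UL) (s_min \<Gamma> n UR)" and "sR \<equiv> max (s_max \<Gamma> n UL) (s_max \<Gamma> n UR)"
  shows "- 1 < sL" and "\<bar>contact_speed \<Gamma> n sL sR UL UR\<bar> < 1"
    and "contact_pressure \<Gamma> n sL sR UL UR * (1 - sL * contact_speed \<Gamma> n sL sR UL UR)
      = contact_speed \<Gamma> n sL sR UL UR * hllc_A n sL UL - hllc_B \<Gamma> n sL UL"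
proof -
  define s where "s = contact_speed \<Gamma> n sL sR UL UR"
  define AL where "AL = hllc_A n sL UL"
  define AR where "AR = hllc_A n sR UR"
  define BL where "BL = hllc_B \<Gamma> n sL UL"
  define BR where "BR = hllc_B \<Gamma> n sR UR"
  note wL = wave_speeds[OF \<Gamma> UL n] and wR = wave_speeds[OF \<Gamma> UR n]
  have sL: "- 1 < sL" and sR: "sR < 1" and "sL < sR" using wL(1-4) wR(1-4) by (auto simp: sL_def sR_def)
  have aL: "\<bar>sL\<bar> < 1" and aR: "\<bar>sR\<bar> < 1" using sL sR \<open>sL < sR\<close> by auto
  have fanL: "sR * AL - BL < 0" and fanR: "sL * AR - BR < 0"
    unfolding AL_def BL_def AR_def BR_def
    by (rule wave_fan[OF \<Gamma> _ n]; simp add: UL UR sL_def sR_def)+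
  \<comment> \<open>The identity behind \<open>wave_fan\<close> with equal speeds: the product of
    differences becomes a square and both terms are nonnegative.\<close>
  have outer_pos: "0 < t * hllc_A n t U - hllc_B \<Gamma> n t U" if U: "U \<in> admissible \<Gamma>" and t: "\<bar>t\<bar> < 1" for t U
  proof -
    obtain g w W where *: "0 < w" "mom U = w *\<^sub>R velocity \<Gamma> U" "U $ 4 = w - pressure \<Gamma> U"
      by (rule admissible_coords[OF \<Gamma> U])
    have "0 < w * (t - velocity \<Gamma> U \<bullet> n)\<^sup>2 + pressure \<Gamma> U * (1 - t\<^sup>2)"
      using *(1) t admissible_primitive(2)[OF U] by (intro add_nonneg_pos mult_pos_pos) (auto simp: abs_square_less_1)
    also have "\<dots> = t * hllc_A n t U - hllc_B \<Gamma> n t U"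
      by (simp add: hllc_A_def hllc_B_def *(2,3)) (simp add: algebra_simps power2_eq_square)
    finally show ?thesis .
  qed
  define C0 where "C0 = BR - BL"
  define C1 where "C1 = AL + sR * BL - AR - sL * BR"
  define C2 where "C2 = sL * AR - sR * AL"
  have Q: "C0 + C1 * t + C2 * t\<^sup>2 = (t * AL - BL) * (1 - sR * t) - (t * AR - BR) * (1 - sL * t)" for t
    by (simp add: C0_def C1_def C2_def algebra_simps power2_eq_square)
  have QL: "0 < C0 + C1 * sL + C2 * sL\<^sup>2"
  proof -
    have "0 < (sL * AL - BL) * (1 - sR * sL)"
      using outer_pos[OF UL aL] mult_less_one_abs[OF aR aL] by (simp add: AL_def BL_def)
    moreover have "(sL * AR - BR) * (1 - sL * sL) < 0"
      using fanR mult_less_one_abs[OF aL aL] by (intro mult_neg_pos) auto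
    ultimately show ?thesis unfolding Q by linarith
  qed
  have QR: "C0 + C1 * sR + C2 * sR\<^sup>2 < 0"
  proof -
    have "0 < (sR * AR - BR) * (1 - sL * sR)"
      using outer_pos[OF UR aR] mult_less_one_abs[OF aL aR] by (simp add: AR_def BR_def)
    moreover have "(sR * AL - BL) * (1 - sR * sR) < 0"
      using fanL mult_less_one_abs[OF aR aR] by (intro mult_neg_pos) auto
    ultimately show ?thesis unfolding Q by linarith
  qed
  have s_eq: "s = (if C2 = 0 then - C0 / C1 else (- C1 - sqrt (C1\<^sup>2 - 4 * C0 * C2)) / (2 * C2))"
    unfolding s_def contact_speed_def Let_def C0_def C1_def C2_def AL_def AR_def BL_def BR_def ..
  have "sL < s" "s < sR" using quadratic_root_between(1,2)[OF \<open>sL < sR\<close> QL QR] unfolding s_eq by auto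
  then have s: "\<bar>s\<bar> < 1" using sL sR by auto
  show "- 1 < sL" by (rule sL)
  show "\<bar>contact_speed \<Gamma> n sL sR UL UR\<bar> < 1" using s by (simp add: s_def)
  show "contact_pressure \<Gamma> n sL sR UL UR * (1 - sL * contact_speed \<Gamma> n sL sR UL UR)
      = contact_speed \<Gamma> n sL sR UL UR * hllc_A n sL UL - hllc_B \<Gamma> n sL UL"
    using mult_less_one_abs[OF aL s] by (simp add: contact_pressure_def Let_def flip: s_def)
qed

lemma edge_update_admissible:
  assumes \<Gamma>: "1 < \<Gamma>" "\<Gamma> \<le> 2" and UL: "UL \<in> admissible \<Gamma>" and UR: "UR \<in> admissible \<Gamma>" and n: "norm n = 1"
    and S: "\<bar>s_min \<Gamma> n UL\<bar> \<le> S" "\<bar>s_max \<Gamma> n UL\<bar> \<le> S" "\<bar>s_min \<Gamma> n UR\<bar> \<le> S"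
    and c: "0 < c" and \<mu>: "0 \<le> \<mu>" "2 * S * \<mu> \<le> c"
  shows "c *\<^sub>R UL - \<mu> *\<^sub>R hllc_flux \<Gamma> n (min (s_min \<Gamma> n UL) (s_min \<Gamma> n UR))
    (max (s_max \<Gamma> n UL) (s_max \<Gamma> n UR)) UL UR \<in> admissible \<Gamma>"
proof (cases "\<mu> = 0")
  case True
  then show ?thesis using admissible_scaleR[OF \<Gamma> UL c] by simp
next
  case False
  then have \<mu>0: "0 < \<mu>" using \<mu> by simp
  define sL where "sL = min (s_min \<Gamma> n UL) (s_min \<Gamma> n UR)"
  define sR where "sR = max (s_max \<Gamma> n UL) (s_max \<Gamma> n UR)"
  define s where "s = contact_speed \<Gamma> n sL sR UL UR"
  define P where "P = contact_pressure \<Gamma> n sL sR UL UR"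
  define u where "u = velocity \<Gamma> UL \<bullet> n"
  define p where "p = pressure \<Gamma> UL"
  \<comment> \<open>Chosen so that the star-state part and the flux-splitting part add up to
    \<open>c / \<mu>\<close> times \<open>UL\<close> minus the HLLC flux.\<close>
  define \<alpha> where "\<alpha> = c / \<mu> + sL"
  note cw = contact_wave[OF \<Gamma> UL UR n, folded sL_def sR_def, folded s_def P_def]
  have V: "(u - sL) *\<^sub>R UL + pressure_flux n p u - pressure_flux n P s \<in> admissible \<Gamma>"
    unfolding u_def p_def by (rule star_state_admissible[OF \<Gamma> UL n cw(1) _ cw(2,3)]) (simp add: sL_def)
  \<comment> \<open>One \<open>S\<close> compensates \<open>sL\<close>, which may be as low as
    \<open>- S\<close>; the other dominates \<open>s_max\<close>. This is the factor 2 that the CFL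
    bound 1/2 provides.\<close>
  have "2 * S \<le> c / \<mu>" using \<mu>0 \<mu> by (simp add: pos_le_divide_eq)
  moreover have "- S \<le> sL" using S by (auto simp: sL_def)
  ultimately have "s_max \<Gamma> n UL \<le> \<alpha>" using S(2) unfolding \<alpha>_def by linarith
  from flux_splitting[OF \<Gamma> UL n this]
  have R: "(\<alpha> - u) *\<^sub>R UL - pressure_flux n p u \<in> admissible \<Gamma>" by (simp add: u_def p_def)
  have "((u - sL) *\<^sub>R UL + pressure_flux n p u - pressure_flux n P s)
      + ((\<alpha> - u) *\<^sub>R UL - pressure_flux n p u) = (c / \<mu>) *\<^sub>R UL - pressure_flux n P s"
    by (simp add: \<alpha>_def algebra_simps)
  then have "(c / \<mu>) *\<^sub>R UL - pressure_flux n P s \<in> admissible \<Gamma>"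
    using admissible_add[OF \<Gamma> V R] by (simp only:)
  from admissible_scaleR[OF \<Gamma> this \<mu>0]
  have "c *\<^sub>R UL - \<mu> *\<^sub>R pressure_flux n P s \<in> admissible \<Gamma>"
    using \<mu>0 by (simp add: scaleR_right_diff_distrib)
  also have "pressure_flux n P s = hllc_flux \<Gamma> n sL sR UL UR"
    by (simp add: hllc_flux_def pressure_flux_def Let_def P_def s_def)
  finally show ?thesis by (simp add: sL_def sR_def)
qed

lemma edge_update_admissible_cfl:
  assumes \<Gamma>: "1 < \<Gamma>" "\<Gamma> \<le> 2" and UL: "UL \<in> admissible \<Gamma>" and UR: "UR \<in> admissible \<Gamma>" and n: "norm n = 1"
    and P: "finite P" "(n, UL) \<in> P" "(n, UR) \<in> P"
    and c: "0 < c" and \<mu>: "0 \<le> \<mu>" "2 * max_speed \<Gamma> P * \<mu> \<le> c"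
  shows "c *\<^sub>R UL - \<mu> *\<^sub>R hllc_flux \<Gamma> n (min (s_min \<Gamma> n UL) (s_min \<Gamma> n UR))
    (max (s_max \<Gamma> n UL) (s_max \<Gamma> n UR)) UL UR \<in> admissible \<Gamma>"
proof -
  have *: "max \<bar>s_min \<Gamma> n W\<bar> \<bar>s_max \<Gamma> n W\<bar> \<le> max_speed \<Gamma> P" if "(n, W) \<in> P" for W
    unfolding max_speed_def using P(1) that by (intro Max_ge) (auto intro!: rev_image_eqI)
  show ?thesis
    using *[OF P(2)] *[OF P(3)] by (intro edge_update_admissible[OF \<Gamma> UL UR n _ _ _ c \<mu>]) auto
qed

section \<open>Positive Jacobians and edgewise consequences of the time step bound\<close>

section \<open>The time step restriction\<close>

lemma ref_point_in_square: "ref_point \<alpha> \<beta> \<in> ref_square"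
  by (simp add: ref_point_def ref_square_def mem_box_cart forall_2 simpson_node_def)

lemma jac_pos:
  assumes "coord_transformation x i j \<phi>"
  shows "0 < jac \<phi> \<alpha> \<beta>"
  using assms ref_point_in_square by (simp add: coord_transformation_def jac_def)

lemma simpson_weight_pos: "0 < simpson_weight \<alpha>"
  by (simp add: simpson_weight_def)

lemma omega_star_pos:
  assumes "coord_transformation x i j \<phi>"
  shows "0 < omega_star \<phi> m"
  unfolding omega_star_def Let_def
  by (simp split: if_split, intro conjI impI sum_pos mult_pos_pos)
     (auto simp: simpson_weight_pos jac_pos[OF assms])

lemma finite_edge_jacs: "finite {edge_jac \<phi> m \<alpha> | m \<alpha>. m \<in> {1..4} \<and> \<alpha> \<in> {1..3}}"
proof -
  have "{edge_jac \<phi> m \<alpha> | m \<alpha>. m \<in> {1..4} \<and> \<alpha> \<in> {1..3}}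
      = (\<lambda>(m, \<alpha>). edge_jac \<phi> m \<alpha>) ` ({1..4} \<times> {1..3})" by auto blast
  then show ?thesis by simp
qed

lemma J_cell_le:
  assumes "m \<in> {1..4}" "\<alpha> \<in> {1..3}"
  shows "J_cell \<phi> \<le> edge_jac \<phi> m \<alpha>"
  unfolding J_cell_def using assms by (intro Min_le finite_edge_jacs) auto

lemma J_cell_nonneg: "0 \<le> J_cell \<phi>"
proof -
  have "J_cell \<phi> \<in> {edge_jac \<phi> m \<alpha> | m \<alpha>. m \<in> {1..4} \<and> \<alpha> \<in> {1..3}}"
    unfolding J_cell_def
  proof (intro Min_in finite_edge_jacs)
    have "1 \<in> {1..4::nat}" "1 \<in> {1..3::nat}" by simp_all
    then show "{edge_jac \<phi> m \<alpha> | m \<alpha>. m \<in> {1..4} \<and> \<alpha> \<in> {1..3}} \<noteq> {}" by blast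
  qed
  then show ?thesis by (auto simp: edge_jac_def jac_def)
qed

lemma max_speed_nonneg:
  assumes "finite P" "P \<noteq> {}"
  shows "0 \<le> max_speed \<Gamma> P"
proof -
  have "max_speed \<Gamma> P \<in> (\<lambda>(n, W). max \<bar>s_min \<Gamma> n W\<bar> \<bar>s_max \<Gamma> n W\<bar>) ` P"
    unfolding max_speed_def using assms by (intro Min_in Max_in) auto
  then show ?thesis by (auto simp: le_max_iff_disj)
qed

lemma edge_length_le_perimeter:
  assumes "m \<in> {1..4}"
  shows "edge_length x i j m \<le> perimeter x i j"
  unfolding perimeter_def using assms by (intro member_le_sum) (auto simp: edge_length_def)

lemma finite_edge_values: "finite (edge_values nrm Um i j \<alpha>)"
  by (simp add: edge_values_def)

text \<open>The bound is localized to one Simpson point: the minimum is at most the entry there, the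
  edge length is at most the perimeter, \<open>J_cell\<close> is at most the local Jacobian, and
  \<open>lam \<le> 1/2\<close> cancels the factor 2.\<close>

lemma cfl_edge:
  fixes Nx Ny :: int
  assumes dt: "0 < dt" and lam: "lam \<le> 1/2"
    and cfl: "dt \<le> simpson_weight 1 / 4 * lam *
                Min {J_cell (\<phi> i j) / perimeter x i j / max_speed \<Gamma> (edge_values nrm Um i j \<alpha>)
                     | i j \<alpha>. (i, j) \<in> mesh_cells Nx Ny \<and> \<alpha> \<in> {1..3}}"
    and ij: "(i, j) \<in> mesh_cells Nx Ny" and m: "m \<in> {1..4}" and \<alpha>: "\<alpha> \<in> {1..3}"
  shows "2 * max_speed \<Gamma> (edge_values nrm Um i j \<alpha>) * (dt * edge_length x i j m)
    \<le> simpson_weight 1 / 4 * edge_jac (\<phi> i j) m \<alpha>"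
proof -
  define q where "q = (\<lambda>i j \<alpha>. J_cell (\<phi> i j) / perimeter x i j / max_speed \<Gamma> (edge_values nrm Um i j \<alpha>))"
  define Q where "Q = {q i j \<alpha> | i j \<alpha>. (i, j) \<in> mesh_cells Nx Ny \<and> \<alpha> \<in> {1..3}}"
  define J where "J = J_cell (\<phi> i j)"
  define L where "L = perimeter x i j"
  define S where "S = max_speed \<Gamma> (edge_values nrm Um i j \<alpha>)"
  have S0: "0 \<le> max_speed \<Gamma> (edge_values nrm Um i j \<alpha>)" for i j \<alpha>
    by (rule max_speed_nonneg[OF finite_edge_values]) (auto simp: edge_values_def)
  have L0: "0 \<le> perimeter x i j" for i j by (simp add: perimeter_def edge_length_def sum_nonneg)
  have "Q = (\<lambda>((i, j), \<alpha>). q i j \<alpha>) ` (mesh_cells Nx Ny \<times> {1..3})" by (force simp: Q_def)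
  then have finQ: "finite Q" by (simp add: mesh_cells_def)
  have qQ: "q i j \<alpha> \<in> Q" using ij \<alpha> unfolding Q_def by blast
  then have "Min Q \<in> Q" using finQ by (intro Min_in) auto
  moreover have "0 \<le> q i j \<alpha>" for i j \<alpha>
    unfolding q_def by (intro divide_nonneg_nonneg J_cell_nonneg L0 S0)
  then have "\<forall>z\<in>Q. 0 \<le> z" by (auto simp: Q_def)
  ultimately have M0: "0 \<le> Min Q" by blast
  have cfl': "dt \<le> simpson_weight 1 / 4 * lam * Min Q" using cfl by (simp add: Q_def q_def)
  \<comment> \<open>Division by zero yields 0, so a vanishing perimeter or speed would give a zero
    entry in \<open>Q\<close>. As no entry is negative, \<open>0 < dt\<close> forces both
    \<open>lam\<close> and \<open>Min Q\<close> to be positive, which excludes such entries.\<close>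
  have pos: "0 < simpson_weight 1 / 4 * lam * Min Q" using dt cfl' by linarith
  have lam0: "0 < lam" using pos M0 by (auto simp: zero_less_mult_iff simpson_weight_def)
  then have "0 < Min Q" using pos by (simp add: zero_less_mult_iff simpson_weight_def)
  moreover have Mq: "Min Q \<le> q i j \<alpha>" by (rule Min_le[OF finQ qQ])
  ultimately have "0 < q i j \<alpha>" by linarith
  then have LS: "0 < L" "0 < S"
    using L0[of i j] S0[of i j \<alpha>] by (auto simp: q_def L_def S_def order_less_le)
  have "dt \<le> simpson_weight 1 / 4 * (lam * Min Q)" using cfl' by (simp add: mult.assoc)
  also have "\<dots> \<le> simpson_weight 1 / 4 * (1/2 * q i j \<alpha>)"
    using lam lam0 Mq M0 by (intro mult_left_mono mult_mono) (auto simp: simpson_weight_def)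
  finally have "2 * S * dt \<le> 2 * S * (simpson_weight 1 / 4 * (1/2 * q i j \<alpha>))"
    using LS by (intro mult_left_mono) auto
  also have "\<dots> = simpson_weight 1 / 4 * (J / L)" using LS
    by (simp add: q_def flip: J_def L_def S_def)
  finally have "2 * S * dt * edge_length x i j m \<le> simpson_weight 1 / 4 * (J / L) * L"
  proof (rule mult_mono)
    show "edge_length x i j m \<le> L" unfolding L_def by (rule edge_length_le_perimeter[OF m])
    show "0 \<le> simpson_weight 1 / 4 * (J / L)"
      using J_cell_nonneg[of "\<phi> i j"] LS by (simp add: J_def simpson_weight_def)
  qed (simp add: edge_length_def)
  also have "\<dots> = simpson_weight 1 / 4 * J" using LS by simp
  also have "\<dots> \<le> simpson_weight 1 / 4 * edge_jac (\<phi> i j) m \<alpha>"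
    using J_cell_le[OF m \<alpha>] by (intro mult_left_mono) (auto simp: J_def simpson_weight_def)
  finally show ?thesis by (simp add: S_def mult.assoc)
qed

section \<open>Splitting of the update over the four edges\<close>

lemma update_decomposition:
  fixes F :: "nat \<Rightarrow> nat \<Rightarrow> state"
  assumes "\<And>m. omega_star (\<phi> i j) m \<noteq> 0"
  shows "cell_area x i j *\<^sub>R Ub i j
      - dt *\<^sub>R (\<Sum>m=1..4. \<Sum>\<alpha>=1..3. (simpson_weight \<alpha> * edge_length x i j m) *\<^sub>R F m \<alpha>)
    = (\<Sum>m=1..4. (1/4 * omega_star (\<phi> i j) m) *\<^sub>R U_star_star x \<phi> Ub Um i j m
      + (\<Sum>\<alpha>=1..3. simpson_weight \<alpha> *\<^sub>R ((simpson_weight 1 / 4 * edge_jac (\<phi> i j) m \<alpha>) *\<^sub>R Um i j m \<alpha>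
          - (dt * edge_length x i j m) *\<^sub>R F m \<alpha>)))"
    (is "_ = (\<Sum>m=1..4. ?t m)")
proof -
  \<comment> \<open>Solved for the average, the definition of \<open>U_star_star\<close> writes area
    times average as \<open>omega_star\<close> times \<open>U_star_star\<close> plus weighted limits
    on edge \<open>m\<close>. Each edge uses a quarter of this identity, hence
    \<open>simpson_weight 1 / 4\<close>.\<close>
  have "?t m = (1/4) *\<^sub>R (cell_area x i j *\<^sub>R Ub i j)
      - dt *\<^sub>R (\<Sum>\<alpha>=1..3. (simpson_weight \<alpha> * edge_length x i j m) *\<^sub>R F m \<alpha>)" for m
  proof -
    have "(1/4 * omega_star (\<phi> i j) m) *\<^sub>R U_star_star x \<phi> Ub Um i j m
        = (1/4) *\<^sub>R (cell_area x i j *\<^sub>R Ub i j)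
        - (\<Sum>\<alpha>=1..3. simpson_weight \<alpha> *\<^sub>R (simpson_weight 1 / 4 * edge_jac (\<phi> i j) m \<alpha>) *\<^sub>R Um i j m \<alpha>)"
      using assms[of m] by (simp add: U_star_star_def scaleR_right_diff_distrib scaleR_sum_right mult_ac)
    moreover have "dt *\<^sub>R (\<Sum>\<alpha>=1..3. (simpson_weight \<alpha> * edge_length x i j m) *\<^sub>R F m \<alpha>)
        = (\<Sum>\<alpha>=1..3. simpson_weight \<alpha> *\<^sub>R (dt * edge_length x i j m) *\<^sub>R F m \<alpha>)"
      by (simp add: scaleR_sum_right mult_ac)
    ultimately show ?thesis by (simp only: scaleR_right_diff_distrib sum_subtractf) simp
  qed
  then have "(\<Sum>m=1..4. ?t m) = (\<Sum>m=1..(4::nat). (1/4) *\<^sub>R (cell_area x i j *\<^sub>R Ub i j))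
      - (\<Sum>m=1..4. dt *\<^sub>R (\<Sum>\<alpha>=1..3. (simpson_weight \<alpha> * edge_length x i j m) *\<^sub>R F m \<alpha>))"
    by (simp only: sum_subtractf)
  also have "(\<Sum>m=1..(4::nat). (1/4) *\<^sub>R (cell_area x i j *\<^sub>R Ub i j)) = cell_area x i j *\<^sub>R Ub i j"
    by (simp only: sum_constant_scaleR) simp
  finally show ?thesis by (simp only: scaleR_sum_right)
qed

theorem theorem3p4:
  fixes \<Gamma> dt lam :: real
    and Nx Ny :: int
    and x :: "int \<Rightarrow> int \<Rightarrow> real^2"
    and nrm :: "int \<Rightarrow> int \<Rightarrow> nat \<Rightarrow> real^2"
    and \<phi> :: "int \<Rightarrow> int \<Rightarrow> real^2 \<Rightarrow> real^2"
    and Ub Unew :: "int \<Rightarrow> int \<Rightarrow> state"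
    and Um :: "int \<Rightarrow> int \<Rightarrow> nat \<Rightarrow> nat \<Rightarrow> state"
    and sm sp :: "real^2 \<Rightarrow> state \<Rightarrow> state \<Rightarrow> real"
  assumes "1 < \<Gamma>" and "\<Gamma> \<le> 2"
    and "1 \<le> Nx" and "1 \<le> Ny"
    and mesh: "quad_mesh Nx Ny x nrm \<phi>"
    and weno: "\<forall>(i, j)\<in>mesh_cells Nx Ny. \<forall>m\<in>{1..4}.
                 weno_limits \<Gamma> x Ub i j m (nrm i j m) (Um i j m)"
    and limits: "\<forall>(i, j)\<in>mesh_cells Nx Ny. \<forall>m\<in>{1..4}. \<forall>\<alpha>\<in>{1..3}.
                   Um i j m \<alpha> \<in> admissible \<Gamma> \<and> outer Um i j m \<alpha> \<in> admissible \<Gamma>"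
    and averages: "\<forall>(i, j)\<in>mesh_cells Nx Ny. Ub i j \<in> admissible \<Gamma>"
    and star: "\<forall>(i, j)\<in>mesh_cells Nx Ny. \<forall>m\<in>{1..4}.
                 U_star_star x \<phi> Ub Um i j m \<in> admissible \<Gamma>"
    and speed_minus: "\<And>n UL UR. sm n UL UR = min (s_min \<Gamma> n UL) (s_min \<Gamma> n UR)"
    and speed_plus: "\<And>n UL UR. sp n UL UR = max (s_max \<Gamma> n UL) (s_max \<Gamma> n UR)"
    and "0 < dt"
    and "lam \<le> 1/2"
    and cfl: "dt \<le> simpson_weight 1 / 4 * lam *
                Min {J_cell (\<phi> i j) / perimeter x i j / max_speed \<Gamma> (edge_values nrm Um i j \<alpha>)
                     | i j \<alpha>. (i, j) \<in> mesh_cells Nx Ny \<and> \<alpha> \<in> {1..3}}"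
    and scheme: "\<forall>(i, j)\<in>mesh_cells Nx Ny.
                   euler_step \<Gamma> sm sp x nrm Um dt Ub i j (Unew i j)"
  shows "\<forall>(i, j)\<in>mesh_cells Nx Ny. Unew i j \<in> admissible \<Gamma>"
proof safe
  fix i j assume ij: "(i, j) \<in> mesh_cells Nx Ny"
  note \<Gamma> = \<open>1 < \<Gamma>\<close> \<open>\<Gamma> \<le> 2\<close>
  have ct: "coord_transformation x i j (\<phi> i j)" using mesh ij unfolding quad_mesh_def by blast
  have nrm: "norm (nrm i j m) = 1" if "m \<in> {1..4}" for m
    using mesh ij that by (auto simp: quad_mesh_def mesh_cells_def outward_normal_def)
  define F where "F = (\<lambda>m \<alpha>. let n = nrm i j m; UL = Um i j m \<alpha>; UR = outer Um i j m \<alpha>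
    in hllc_flux \<Gamma> n (sm n UL UR) (sp n UL UR) UL UR)"
  define R where "R = cell_area x i j *\<^sub>R Ub i j
    - dt *\<^sub>R (\<Sum>m=1..4. \<Sum>\<alpha>=1..3. (simpson_weight \<alpha> * edge_length x i j m) *\<^sub>R F m \<alpha>)"
  have \<omega>: "0 < omega_star (\<phi> i j) m" for m by (rule omega_star_pos[OF ct])
  have edge: "(simpson_weight 1 / 4 * edge_jac (\<phi> i j) m \<alpha>) *\<^sub>R Um i j m \<alpha>
      - (dt * edge_length x i j m) *\<^sub>R F m \<alpha> \<in> admissible \<Gamma>"
    if m: "m \<in> {1..4}" and \<alpha>: "\<alpha> \<in> {1..3}" for m \<alpha>
    unfolding F_def Let_def speed_minus speed_plus
  proof (rule edge_update_admissible_cfl[OF \<Gamma> _ _ nrm[OF m] finite_edge_values])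
    show "Um i j m \<alpha> \<in> admissible \<Gamma>" "outer Um i j m \<alpha> \<in> admissible \<Gamma>"
      using limits ij m \<alpha> by blast+
    show "(nrm i j m, Um i j m \<alpha>) \<in> edge_values nrm Um i j \<alpha>"
      "(nrm i j m, outer Um i j m \<alpha>) \<in> edge_values nrm Um i j \<alpha>"
      using m unfolding edge_values_def by blast+
    show "0 < simpson_weight 1 / 4 * edge_jac (\<phi> i j) m \<alpha>"
      using jac_pos[OF ct] by (simp add: edge_jac_def simpson_weight_pos)
    show "0 \<le> dt * edge_length x i j m" using \<open>0 < dt\<close> by (simp add: edge_length_def)
    show "2 * max_speed \<Gamma> (edge_values nrm Um i j \<alpha>) * (dt * edge_length x i j m)
        \<le> simpson_weight 1 / 4 * edge_jac (\<phi> i j) m \<alpha>"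
      by (rule cfl_edge[OF \<open>0 < dt\<close> \<open>lam \<le> 1/2\<close> cfl ij m \<alpha>])
  qed
  have R: "R \<in> admissible \<Gamma>"
    unfolding R_def update_decomposition[where Um = Um and \<phi> = \<phi>, OF less_imp_neq[OF \<omega>, symmetric]]
  proof (intro admissible_sum[OF \<Gamma>] admissible_add[OF \<Gamma>] admissible_scaleR[OF \<Gamma>] edge simpson_weight_pos)
    show "U_star_star x \<phi> Ub Um i j m \<in> admissible \<Gamma>" if "m \<in> {1..4}" for m
      using star ij that by blast
  qed (use \<omega> in auto)
  define A where "A = cell_area (moved \<Gamma> sm sp x nrm Um dt) i j"
  have "euler_step \<Gamma> sm sp x nrm Um dt Ub i j (Unew i j)" using scheme ij by blast
  then have eq: "A *\<^sub>R Unew i j = R"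
    unfolding euler_step_def A_def R_def F_def .
  have "0 < R $ 1" using R by (simp add: admissible_iff[OF \<Gamma>])
  then have "A \<noteq> 0" using eq by auto
  \<comment> \<open>\<open>cell_area\<close> is a Lebesgue measure, not a signed area, so nonzero
    means positive.\<close>
  moreover have "0 \<le> A" by (simp add: A_def cell_area_def)
  ultimately have A: "0 < A" by simp
  then have "Unew i j = (1 / A) *\<^sub>R R" unfolding eq[symmetric] by simp
  then show "Unew i j \<in> admissible \<Gamma>" using admissible_scaleR[OF \<Gamma> R] A by simp
qed

end
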